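(* Let $\mathbf{x}:U\to\mathbb{R}^3$ be a proper wavefront all of whose singularities have rank 1 (i.e. $\mathrm{rank}(D\mathbf{x}(\mathbf{q}))=1$ for every $\mathbf{q}\in\Sigma(\mathbf{x})$), let $\Omega$ be a tangent moving basis of $\mathbf{x}$, and let $\mathbf{p}\in\Sigma(\mathbf{x})$. Let $V\subset U$ be an open neighborhood of $\mathbf{p}$ on which the relative principal curvature $k_{i\Omega}$ ($i\in\{1,2\}$) does not vanish, and let $k_j$ ($\{i,j\}=\{1,2\}$) be the function that admits a $C^\infty$ extension to $V$ (the extension is again denoted $k_j$). Let $K$ be the Gaussian curvature of $\mathbf{x}$. Then the following statements are equivalent: (1) $K$ admits a $C^\infty$ extension to $V$ (i.e. there is a function in $C^\infty(V,\mathbb{R})$ that equals $K$ on $V\setminus\Sigma(\mathbf{x})$). (2) $K_\Omega\in\mathfrak{T}_\Omega(V)$. (3) $k_j\in\mathfrak{T}_\Omega(V)$. (4) $e,f,g\in\mathfrak{T}_\Omega(V)$. Here $\mathfrak{T}_\Omega(V)$ is the principal ideal generated by $\lambda_\Omega$ in the ring $C^\infty(V,\mathbb{R})$.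
   Context: All maps are $C^\infty$; $U\subset\mathbb{R}^2$ is open, with coordinates $(u,v)$. A smooth map $\mathbf{x}:U\to\mathbb{R}^3$ is a frontal if every $\mathbf{p}\in U$ has an open neighborhood $V_p\subset U$ with a smooth unit vector field $\mathbf{n}_p:V_p\to\mathbb{R}^3$ orthogonal to $\mathbf{x}_u,\mathbf{x}_v$; it is a wavefront (front) if moreover each $(\mathbf{x},\mathbf{n}_p)$ is an immersion into $\mathbb{R}^3\times S^2$. The singular set is $\Sigma(\mathbf{x})=\{\mathbf{p}\in U:\mathbf{x}\text{ is not immersive at }\mathbf{p}\}$; $\mathbf{x}$ is proper if $\Sigma(\mathbf{x})$ has empty interior. A tangent moving basis (tmb) of $\mathbf{x}$ is a smooth map $\Omega=(\mathbf{w}_1\ \mathbf{w}_2):U\to\mathcal{M}_{3\times2}(\mathbb{R})$ with linearly independent columns at each point and $\mathbf{x}_u,\mathbf{x}_v\in\mathrm{span}(\mathbf{w}_1,\mathbf{w}_2)$. Put $\mathbf{n}=\frac{\mathbf{w}_1\times\mathbf{w}_2}{\|\mathbf{w}_1\times\mathbf{w}_2\|}$, $\mathbf{I}_\Omega=\Omega^T\Omega$, $\mathbf{II}_\Omega=-\Omega^TD\mathbf{n}$, $\mu_\Omega=-\mathbf{II}_\Omega^T\mathbf{I}_\Omega^{-1}$, $\Lambda_\Omega=D\mathbf{x}^T\Omega\,\mathbf{I}_\Omega^{-1}$, $\lambda_\Omega=\det\Lambda_\Omega$, $K_\Omega=\det\mu_\Omega$, $H_\Omega=-\frac12\mathrm{tr}(\mu_\Omega\,\mathrm{adj}(\Lambda_\Omega))$.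 One has $D\mathbf{x}=\Omega\Lambda_\Omega^T$ and $D\mathbf{n}=\Omega\mu_\Omega^T$, so $\Sigma(\mathbf{x})=\lambda_\Omega^{-1}(0)$. The fundamental forms are $\begin{pmatrix} E & F \\ F & G \end{pmatrix}=D\mathbf{x}^TD\mathbf{x}$ and $\begin{pmatrix} e & f \\ f & g \end{pmatrix}=-D\mathbf{x}^TD\mathbf{n}$ on $U$; on $U\setminus\Sigma(\mathbf{x})$, $K=\frac{eg-f^2}{EG-F^2}$ and $H=\frac{eG+gE-2fF}{2(EG-F^2)}$ are the Gaussian and mean curvatures. The relative principal curvatures are $k_{1\Omega}=H_\Omega-\sqrt{H_\Omega^2-\lambda_\Omega K_\Omega}$ and $k_{2\Omega}=H_\Omega+\sqrt{H_\Omega^2-\lambda_\Omega K_\Omega}$ on $U$. On $U\setminus\Sigma(\mathbf{x})$: $k_1=H-\sqrt{H^2-K}$ and $k_2=H+\sqrt{H^2-K}$ where $\lambda_\Omega>0$; $k_1=H+\sqrt{H^2-K}$ and $k_2=H-\sqrt{H^2-K}$ where $\lambda_\Omega<0$. *)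

theory Defs
  imports "HOL-Analysis.Analysis"
begin

unbundle cross3_syntax

text \<open>Classes \<open>C\<^sup>k\<close> and \<open>C\<^sup>\<infinity>\<close> on an open set \<open>S\<close>, by iterated directional derivatives. On an open
  set only the values of the function on \<open>S\<close> matter, so functions on \<open>S\<close> are represented by total
  functions with irrelevant values outside \<open>S\<close>.\<close>

primrec Ck_on :: "nat \<Rightarrow> ('a::euclidean_space \<Rightarrow> 'b::real_normed_vector) \<Rightarrow> 'a set \<Rightarrow> bool" where
  "Ck_on 0 f S \<longleftrightarrow> continuous_on S f"
| "Ck_on (Suc k) f S \<longleftrightarrow>
     (\<forall>x\<in>S. f differentiable at x) \<and> (\<forall>v. Ck_on k (\<lambda>x. frechet_derivative f (at x) v) S)"

definition smooth_on :: "('a::euclidean_space \<Rightarrow> 'b::real_normed_vector) \<Rightarrow> 'a set \<Rightarrow> bool" where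
  "smooth_on f S \<longleftrightarrow> (\<forall>k. Ck_on k f S)"

definition smooth_principal_ideal :: "'a::euclidean_space set \<Rightarrow> ('a \<Rightarrow> real) \<Rightarrow> ('a \<Rightarrow> real) set" where
  "smooth_principal_ideal V g = {h. \<exists>\<phi>. smooth_on \<phi> V \<and> (\<forall>q\<in>V. h q = \<phi> q * g q)}"

definition immersive_at :: "('a::euclidean_space \<Rightarrow> 'b::real_normed_vector) \<Rightarrow> 'a \<Rightarrow> bool" where
  "immersive_at f q \<longleftrightarrow> f differentiable at q \<and> inj (frechet_derivative f (at q))"

definition singular_set :: "(real^2 \<Rightarrow> real^3) \<Rightarrow> (real^2) set \<Rightarrow> (real^2) set" where
  "singular_set x U = {q\<in>U. \<not> immersive_at x q}"

definition unit_normal_field_on :: "(real^2 \<Rightarrow> real^3) \<Rightarrow> (real^2 \<Rightarrow> real^3) \<Rightarrow> (real^2) set \<Rightarrow> bool" where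
  "unit_normal_field_on x n V \<longleftrightarrow> smooth_on n V \<and>
     (\<forall>q\<in>V. norm (n q) = 1 \<and>
        n q \<bullet> column 1 (jacobian x (at q)) = 0 \<and> n q \<bullet> column 2 (jacobian x (at q)) = 0)"

text \<open>Since the field \<open>n\<close> takes values in the unit sphere, \<open>(x, n)\<close> is an immersion into
  \<open>\<real>\<^sup>3 \<times> S\<^sup>2\<close> iff it is one into \<open>\<real>\<^sup>3 \<times> \<real>\<^sup>3\<close>.\<close>

definition wavefront :: "(real^2 \<Rightarrow> real^3) \<Rightarrow> (real^2) set \<Rightarrow> bool" where
  "wavefront x U \<longleftrightarrow> smooth_on x U \<and>
     (\<forall>p\<in>U. \<exists>V n. open V \<and> p \<in> V \<and> V \<subseteq> U \<and> unit_normal_field_on x n V \<and>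
        (\<forall>q\<in>V. immersive_at (\<lambda>r. (x r, n r)) q))"

definition proper_on :: "(real^2 \<Rightarrow> real^3) \<Rightarrow> (real^2) set \<Rightarrow> bool" where
  "proper_on x U \<longleftrightarrow> interior (singular_set x U) = {}"

text \<open>The condition that the two columns differ is needed because \<open>independent\<close> is a property of
  the set of columns.\<close>

definition tangent_moving_basis ::
    "(real^2 \<Rightarrow> real^3) \<Rightarrow> (real^2) set \<Rightarrow> (real^2 \<Rightarrow> real^2^3) \<Rightarrow> bool" where
  "tangent_moving_basis x U \<Omega> \<longleftrightarrow> smooth_on \<Omega> U \<and>
     (\<forall>q\<in>U. column 1 (\<Omega> q) \<noteq> column 2 (\<Omega> q) \<and> independent {column 1 (\<Omega> q), column 2 (\<Omega> q)} \<and>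
        column 1 (jacobian x (at q)) \<in> span {column 1 (\<Omega> q), column 2 (\<Omega> q)} \<and>
        column 2 (jacobian x (at q)) \<in> span {column 1 (\<Omega> q), column 2 (\<Omega> q)})"

definition tmb_normal :: "(real^2 \<Rightarrow> real^2^3) \<Rightarrow> real^2 \<Rightarrow> real^3" where
  "tmb_normal \<Omega> q =
     (let w = column 1 (\<Omega> q) \<times> column 2 (\<Omega> q) in (1 / norm w) *\<^sub>R w)"

definition I_tmb :: "(real^2 \<Rightarrow> real^2^3) \<Rightarrow> real^2 \<Rightarrow> real^2^2" where
  "I_tmb \<Omega> q = transpose (\<Omega> q) ** \<Omega> q"

definition II_tmb :: "(real^2 \<Rightarrow> real^2^3) \<Rightarrow> real^2 \<Rightarrow> real^2^2" where
  "II_tmb \<Omega> q = - (transpose (\<Omega> q) ** jacobian (tmb_normal \<Omega>) (at q))"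

definition mu_tmb :: "(real^2 \<Rightarrow> real^2^3) \<Rightarrow> real^2 \<Rightarrow> real^2^2" where
  "mu_tmb \<Omega> q = - (transpose (II_tmb \<Omega> q) ** matrix_inv (I_tmb \<Omega> q))"

definition Lambda_tmb :: "(real^2 \<Rightarrow> real^3) \<Rightarrow> (real^2 \<Rightarrow> real^2^3) \<Rightarrow> real^2 \<Rightarrow> real^2^2" where
  "Lambda_tmb x \<Omega> q = transpose (jacobian x (at q)) ** \<Omega> q ** matrix_inv (I_tmb \<Omega> q)"

definition lambda_tmb :: "(real^2 \<Rightarrow> real^3) \<Rightarrow> (real^2 \<Rightarrow> real^2^3) \<Rightarrow> real^2 \<Rightarrow> real" where
  "lambda_tmb x \<Omega> q = det (Lambda_tmb x \<Omega> q)"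

definition K_tmb :: "(real^2 \<Rightarrow> real^2^3) \<Rightarrow> real^2 \<Rightarrow> real" where
  "K_tmb \<Omega> q = det (mu_tmb \<Omega> q)"

definition adjugate2 :: "real^2^2 \<Rightarrow> real^2^2" where
  "adjugate2 A = vector [vector [A$2$2, - A$1$2], vector [- A$2$1, A$1$1]]"

definition H_tmb :: "(real^2 \<Rightarrow> real^3) \<Rightarrow> (real^2 \<Rightarrow> real^2^3) \<Rightarrow> real^2 \<Rightarrow> real" where
  "H_tmb x \<Omega> q = - (1/2) * trace (mu_tmb \<Omega> q ** adjugate2 (Lambda_tmb x \<Omega> q))"

text \<open>The index \<open>i\<close> of the (relative) principal curvatures is meant to be 1 or 2.\<close>

definition relative_principal_curvature ::
    "nat \<Rightarrow> (real^2 \<Rightarrow> real^3) \<Rightarrow> (real^2 \<Rightarrow> real^2^3) \<Rightarrow> real^2 \<Rightarrow> real" where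
  "relative_principal_curvature i x \<Omega> q =
     (let s = sqrt ((H_tmb x \<Omega> q)\<^sup>2 - lambda_tmb x \<Omega> q * K_tmb \<Omega> q)
      in if i = 1 then H_tmb x \<Omega> q - s else H_tmb x \<Omega> q + s)"

definition first_fundamental_form :: "(real^2 \<Rightarrow> real^3) \<Rightarrow> real^2 \<Rightarrow> real^2^2" where
  "first_fundamental_form x q = transpose (jacobian x (at q)) ** jacobian x (at q)"

definition second_fundamental_form ::
    "(real^2 \<Rightarrow> real^3) \<Rightarrow> (real^2 \<Rightarrow> real^2^3) \<Rightarrow> real^2 \<Rightarrow> real^2^2" where
  "second_fundamental_form x \<Omega> q =
     - (transpose (jacobian x (at q)) ** jacobian (tmb_normal \<Omega>) (at q))"

definition coeff_E :: "(real^2 \<Rightarrow> real^3) \<Rightarrow> real^2 \<Rightarrow> real" where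
  "coeff_E x q = first_fundamental_form x q $ 1 $ 1"

definition coeff_F :: "(real^2 \<Rightarrow> real^3) \<Rightarrow> real^2 \<Rightarrow> real" where
  "coeff_F x q = first_fundamental_form x q $ 1 $ 2"

definition coeff_G :: "(real^2 \<Rightarrow> real^3) \<Rightarrow> real^2 \<Rightarrow> real" where
  "coeff_G x q = first_fundamental_form x q $ 2 $ 2"

definition coeff_e :: "(real^2 \<Rightarrow> real^3) \<Rightarrow> (real^2 \<Rightarrow> real^2^3) \<Rightarrow> real^2 \<Rightarrow> real" where
  "coeff_e x \<Omega> q = second_fundamental_form x \<Omega> q $ 1 $ 1"

definition coeff_f :: "(real^2 \<Rightarrow> real^3) \<Rightarrow> (real^2 \<Rightarrow> real^2^3) \<Rightarrow> real^2 \<Rightarrow> real" where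
  "coeff_f x \<Omega> q = second_fundamental_form x \<Omega> q $ 1 $ 2"

definition coeff_g :: "(real^2 \<Rightarrow> real^3) \<Rightarrow> (real^2 \<Rightarrow> real^2^3) \<Rightarrow> real^2 \<Rightarrow> real" where
  "coeff_g x \<Omega> q = second_fundamental_form x \<Omega> q $ 2 $ 2"

text \<open>The curvatures below are meaningful only at regular points of \<open>x\<close>; at singular points
  \<open>EG - F\<^sup>2 = 0\<close> and the division yields a junk value.\<close>

definition gauss_curvature :: "(real^2 \<Rightarrow> real^3) \<Rightarrow> (real^2 \<Rightarrow> real^2^3) \<Rightarrow> real^2 \<Rightarrow> real" where
  "gauss_curvature x \<Omega> q =
     (coeff_e x \<Omega> q * coeff_g x \<Omega> q - (coeff_f x \<Omega> q)\<^sup>2) /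
     (coeff_E x q * coeff_G x q - (coeff_F x q)\<^sup>2)"

definition mean_curvature :: "(real^2 \<Rightarrow> real^3) \<Rightarrow> (real^2 \<Rightarrow> real^2^3) \<Rightarrow> real^2 \<Rightarrow> real" where
  "mean_curvature x \<Omega> q =
     (coeff_e x \<Omega> q * coeff_G x q + coeff_g x \<Omega> q * coeff_E x q - 2 * coeff_f x \<Omega> q * coeff_F x q) /
     (2 * (coeff_E x q * coeff_G x q - (coeff_F x q)\<^sup>2))"

definition principal_curvature ::
    "nat \<Rightarrow> (real^2 \<Rightarrow> real^3) \<Rightarrow> (real^2 \<Rightarrow> real^2^3) \<Rightarrow> real^2 \<Rightarrow> real" where
  "principal_curvature i x \<Omega> q =
     (let H = mean_curvature x \<Omega> q; s = sqrt (H\<^sup>2 - gauss_curvature x \<Omega> q)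
      in if lambda_tmb x \<Omega> q > 0 then (if i = 1 then H - s else H + s)
         else (if i = 1 then H + s else H - s))"

end

theory Submission
  imports Defs
begin

text \<open>
  Write \<open>M\<close> for the second and \<open>E\<close> for the first fundamental form. From \<open>Dx = \<Omega> \<Lambda>\<^sup>T\<close> one gets
  \<open>E = \<Lambda> I \<Lambda>\<^sup>T\<close> and \<open>M = - \<Lambda> I \<mu>\<^sup>T\<close>, hence \<open>K = K\<^sub>\<Omega> / \<lambda>\<^sub>\<Omega>\<close>, \<open>H = H\<^sub>\<Omega> / \<lambda>\<^sub>\<Omega>\<close> and
  \<open>k\<^sub>i = k\<^sub>i\<^sub>\<Omega> / \<lambda>\<^sub>\<Omega>\<close> at regular points, which are dense and are exactly the points where \<open>\<lambda>\<^sub>\<Omega> \<noteq> 0\<close>.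
  By density \<open>K\<^sub>\<Omega> = k\<^sub>i\<^sub>\<Omega> k\<^sub>j\<close> on all of \<open>V\<close>.
  Divisibility by \<open>\<lambda>\<^sub>\<Omega>\<close> only has to be checked near singular points; there \<open>k\<^sub>i\<^sub>\<Omega> \<noteq> 0\<close> forces \<open>H\<^sub>\<Omega> \<noteq> 0\<close>, so
  \<open>H\<^sub>\<Omega>\<^sup>2 - \<lambda>\<^sub>\<Omega> K\<^sub>\<Omega> > 0\<close> and \<open>k\<^sub>i\<^sub>\<Omega>\<close> is smooth there, which gives the equivalence of (2) and (3).
  For (4), symmetry of \<open>M\<close> and the Cayley-Hamilton theorem for \<open>\<mu> adj(\<Lambda>)\<close> give the identity
  \<open>2 H\<^sub>\<Omega> M = \<lambda>\<^sub>\<Omega> \<mu> I \<mu>\<^sup>T + K\<^sub>\<Omega> E\<close>, so \<open>\<lambda>\<^sub>\<Omega> | K\<^sub>\<Omega>\<close> implies \<open>\<lambda>\<^sub>\<Omega> | M\<close>; conversely \<open>M = \<lambda>\<^sub>\<Omega> B\<close> and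
  \<open>det M = \<lambda>\<^sub>\<Omega> K\<^sub>\<Omega> det I\<close> give \<open>K\<^sub>\<Omega> det I = \<lambda>\<^sub>\<Omega> det B\<close>.
\<close>

section \<open>Smooth functions on open sets\<close>

text \<open>A derivative at a point of an open set depends only on the values on that set. This
  allows \<open>frechet_derivative\<close> to be replaced by a formula valid only on
  \<open>S\<close>.\<close>

lemma Ck_on_cong:
  assumes "open S" "\<And>x. x \<in> S \<Longrightarrow> f x = g x"
  shows "Ck_on k f S \<longleftrightarrow> Ck_on k g S"
  using assms(2)
proof (induction k arbitrary: f g)
  case 0
  then show ?case using continuous_on_cong[OF refl, of S f g] by simp
next
  case (Suc k)
  have der: "(f has_derivative D) (at x) \<longleftrightarrow> (g has_derivative D) (at x)" if "x \<in> S" for D x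
    using has_derivative_transform_within_open[OF _ \<open>open S\<close> that] Suc.prems by metis
  then have "f differentiable at x \<longleftrightarrow> g differentiable at x" if "x \<in> S" for x
    using that by (simp add: differentiable_def)
  moreover have "frechet_derivative f (at x) = frechet_derivative g (at x)" if "x \<in> S" for x
    using der[OF that] by (simp add: frechet_derivative_def)
  then have "Ck_on k (\<lambda>x. frechet_derivative f (at x) v) S \<longleftrightarrow>
      Ck_on k (\<lambda>x. frechet_derivative g (at x) v) S" for v
    by (intro Suc.IH) auto
  ultimately show ?case by auto
qed

lemma Ck_on_subset: "Ck_on k f S \<Longrightarrow> T \<subseteq> S \<Longrightarrow> Ck_on k f T"
  by (induction k arbitrary: f) (auto intro: continuous_on_subset)

lemma Ck_on_imp_continuous_on: "Ck_on k f S \<Longrightarrow> continuous_on S f"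
  by (cases k) (auto intro!: continuous_at_imp_continuous_on differentiable_imp_continuous_within)

lemma Ck_on_SucD: "Ck_on (Suc k) f S \<Longrightarrow> Ck_on k f S"
  by (induction k arbitrary: f)
    (auto intro!: continuous_at_imp_continuous_on differentiable_imp_continuous_within)

text \<open>Continuity and differentiability are local, so smoothness can be checked with different
  formulas near different points.\<close>

lemma Ck_on_local:
  assumes "\<And>x. x \<in> S \<Longrightarrow> \<exists>T. open T \<and> x \<in> T \<and> Ck_on k f T"
  shows "Ck_on k f S"
  using assms
proof (induction k arbitrary: f)
  case 0
  then show ?case
    by (metis Ck_on.simps(1) continuous_at_imp_continuous_on continuous_on_eq_continuous_at)
next
  case (Suc k)
  then show ?case
    by (metis Ck_on.simps(2))
qed

lemma Ck_on_const: "Ck_on k (\<lambda>x. c) S"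
  by (induction k arbitrary: c) auto

text \<open>The derivative is \<open>L\<close> applied to the derivative of \<open>f\<close>, hence
  of the same shape, and the induction closes because \<open>f\<close> is generalised. Sums and
  bilinear maps follow the same scheme.\<close>

lemma Ck_on_bounded_linear:
  assumes "open S" "bounded_linear L" "Ck_on k f S"
  shows "Ck_on k (\<lambda>x. L (f x)) S"
  using assms(3)
proof (induction k arbitrary: f)
  case 0
  then show ?case
    using assms(2) by (auto intro: bounded_linear.continuous_on)
next
  case (Suc k)
  have der: "((\<lambda>x. L (f x)) has_derivative (\<lambda>v. L (frechet_derivative f (at x) v))) (at x)"
    if "x \<in> S" for x
    using Suc.prems that
    by (auto intro!: bounded_linear.has_derivative[OF assms(2)] simp flip: frechet_derivative_works)
  have "Ck_on k (\<lambda>x. frechet_derivative (\<lambda>x. L (f x)) (at x) v) S" for v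
  proof (subst Ck_on_cong[OF \<open>open S\<close>])
    show "Ck_on k (\<lambda>x. L (frechet_derivative f (at x) v)) S"
      using Suc by auto
  qed (simp flip: frechet_derivative_at[OF der])
  with der show ?case by (auto simp: differentiable_def)
qed

lemma Ck_on_add:
  assumes "open S" "Ck_on k f S" "Ck_on k g S"
  shows "Ck_on k (\<lambda>x. f x + g x) S"
  using assms(2,3)
proof (induction k arbitrary: f g)
  case 0
  then show ?case by (auto intro: continuous_on_add)
next
  case (Suc k)
  have der: "((\<lambda>x. f x + g x) has_derivative
      (\<lambda>v. frechet_derivative f (at x) v + frechet_derivative g (at x) v)) (at x)"
    if "x \<in> S" for x
    using Suc.prems that by (auto intro!: has_derivative_add simp flip: frechet_derivative_works)
  have "Ck_on k (\<lambda>x. frechet_derivative (\<lambda>x. f x + g x) (at x) v) S" for v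
  proof (subst Ck_on_cong[OF \<open>open S\<close>])
    show "Ck_on k (\<lambda>x. frechet_derivative f (at x) v + frechet_derivative g (at x) v) S"
      using Suc by auto
  qed (simp flip: frechet_derivative_at[OF der])
  with der show ?case by (auto simp: differentiable_def)
qed

lemma Ck_on_bounded_bilinear:
  assumes "open S" "bounded_bilinear B" "Ck_on k f S" "Ck_on k g S"
  shows "Ck_on k (\<lambda>x. B (f x) (g x)) S"
  using assms(3,4)
proof (induction k arbitrary: f g)
  case 0
  then show ?case
    using assms(2) by (auto intro: bounded_bilinear.continuous_on)
next
  case (Suc k)
  have der: "((\<lambda>x. B (f x) (g x)) has_derivative
      (\<lambda>v. B (f x) (frechet_derivative g (at x) v) + B (frechet_derivative f (at x) v) (g x))) (at x)"
    if "x \<in> S" for x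
    using Suc.prems that
    by (auto intro!: bounded_bilinear.FDERIV[OF assms(2)] simp flip: frechet_derivative_works)
  have "Ck_on k (\<lambda>x. frechet_derivative (\<lambda>x. B (f x) (g x)) (at x) v) S" for v
  proof (subst Ck_on_cong[OF \<open>open S\<close>])
    show "Ck_on k (\<lambda>x. B (f x) (frechet_derivative g (at x) v) +
        B (frechet_derivative f (at x) v) (g x)) S"
      using Suc Ck_on_SucD[OF Suc.prems(1)] Ck_on_SucD[OF Suc.prems(2)]
      by (intro Ck_on_add \<open>open S\<close>) auto
  qed (simp flip: frechet_derivative_at[OF der])
  with der show ?case by (auto simp: differentiable_def)
qed

text \<open>The derivative contains \<open>inverse (f x)\<close> for the same \<open>f\<close>, so
  the induction keeps \<open>f\<close> fixed and lowers its order by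
  \<open>Ck_on_SucD\<close>.\<close>

lemma Ck_on_inverse:
  fixes f :: "'a::euclidean_space \<Rightarrow> real"
  assumes "open S" "Ck_on k f S" "\<And>x. x \<in> S \<Longrightarrow> f x \<noteq> 0"
  shows "Ck_on k (\<lambda>x. inverse (f x)) S"
  using assms(2)
proof (induction k)
  case 0
  then show ?case using assms(3) by (auto intro: continuous_on_inverse)
next
  case (Suc k)
  have der: "((\<lambda>x. inverse (f x)) has_derivative
      (\<lambda>v. - (inverse (f x) * frechet_derivative f (at x) v * inverse (f x)))) (at x)"
    if "x \<in> S" for x
    using Suc.prems that assms(3)
    by (auto intro!: has_derivative_inverse simp flip: frechet_derivative_works)
  have "Ck_on k (\<lambda>x. frechet_derivative (\<lambda>x. inverse (f x)) (at x) v) S" for v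
  proof (subst Ck_on_cong[OF \<open>open S\<close>])
    show "Ck_on k (\<lambda>x. - (inverse (f x) * frechet_derivative f (at x) v * inverse (f x))) S"
      using Suc Ck_on_SucD[OF Suc.prems]
      by (intro Ck_on_bounded_linear[OF \<open>open S\<close> bounded_linear_minus[OF bounded_linear_ident]]
          Ck_on_bounded_bilinear[OF \<open>open S\<close> bounded_bilinear_mult]) auto
  qed (simp flip: frechet_derivative_at[OF der])
  with der show ?case by (auto simp: differentiable_def)
qed

text \<open>The derivative is written with \<open>inverse (sqrt (f x))\<close>, so that the
  induction hypothesis followed by \<open>Ck_on_inverse\<close> applies.\<close>

lemma Ck_on_sqrt:
  fixes f :: "'a::euclidean_space \<Rightarrow> real"
  assumes "open S" "Ck_on k f S" "\<And>x. x \<in> S \<Longrightarrow> f x > 0"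
  shows "Ck_on k (\<lambda>x. sqrt (f x)) S"
  using assms(2)
proof (induction k)
  case 0
  then show ?case by (auto intro: continuous_on_real_sqrt)
next
  case (Suc k)
  have der: "((\<lambda>x. sqrt (f x)) has_derivative
      (\<lambda>v. frechet_derivative f (at x) v * (inverse (sqrt (f x)) * (1/2)))) (at x)"
    if "x \<in> S" for x
  proof -
    have "(f has_derivative frechet_derivative f (at x)) (at x)"
      using Suc.prems that by (simp flip: frechet_derivative_works)
    from has_derivative_real_sqrt[OF assms(3)[OF that] this]
    show ?thesis by (simp add: field_simps)
  qed
  have "Ck_on k (\<lambda>x. frechet_derivative (\<lambda>x. sqrt (f x)) (at x) v) S" for v
  proof (subst Ck_on_cong[OF \<open>open S\<close>])
    have "Ck_on k (\<lambda>x. inverse (sqrt (f x))) S"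
      using Suc.IH[OF Ck_on_SucD[OF Suc.prems]] assms(3)
      by (intro Ck_on_inverse \<open>open S\<close>) (auto simp: less_le)
    then show "Ck_on k (\<lambda>x. frechet_derivative f (at x) v * (inverse (sqrt (f x)) * (1/2))) S"
      using Suc.prems
      by (intro Ck_on_bounded_bilinear[OF \<open>open S\<close> bounded_bilinear_mult] Ck_on_const) auto
  qed (simp flip: frechet_derivative_at[OF der])
  with der show ?case by (auto simp: differentiable_def)
qed

section \<open>Closure properties of smooth functions, from finite order to all orders\<close>

lemma smooth_on_cong:
  "open S \<Longrightarrow> (\<And>x. x \<in> S \<Longrightarrow> f x = g x) \<Longrightarrow> smooth_on f S \<longleftrightarrow> smooth_on g S"
  unfolding smooth_on_def using Ck_on_cong by blast

lemma smooth_on_subset: "smooth_on f S \<Longrightarrow> T \<subseteq> S \<Longrightarrow> smooth_on f T"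
  unfolding smooth_on_def using Ck_on_subset by blast

lemma smooth_on_local:
  "(\<And>x. x \<in> S \<Longrightarrow> \<exists>T. open T \<and> x \<in> T \<and> smooth_on f T) \<Longrightarrow> smooth_on f S"
  unfolding smooth_on_def by (meson Ck_on_local)

lemma smooth_on_imp_continuous_on: "smooth_on f S \<Longrightarrow> continuous_on S f"
  unfolding smooth_on_def using Ck_on_imp_continuous_on by blast

lemma smooth_on_imp_differentiable: "smooth_on f S \<Longrightarrow> x \<in> S \<Longrightarrow> f differentiable at x"
  unfolding smooth_on_def by (meson Ck_on.simps(2))

lemma smooth_on_const: "smooth_on (\<lambda>x. c) S"
  by (simp add: smooth_on_def Ck_on_const)

lemma smooth_on_frechet_derivative:
  "smooth_on f S \<Longrightarrow> smooth_on (\<lambda>x. frechet_derivative f (at x) v) S"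
  unfolding smooth_on_def using Ck_on.simps(2)[of _ f S] by simp

context
  fixes S :: "'a::euclidean_space set"
  assumes S: "open S"
begin

lemma smooth_on_bounded_linear:
  "bounded_linear L \<Longrightarrow> smooth_on f S \<Longrightarrow> smooth_on (\<lambda>x. L (f x)) S"
  unfolding smooth_on_def using Ck_on_bounded_linear[OF S] by blast

lemma smooth_on_bounded_bilinear:
  "bounded_bilinear B \<Longrightarrow> smooth_on f S \<Longrightarrow> smooth_on g S \<Longrightarrow> smooth_on (\<lambda>x. B (f x) (g x)) S"
  unfolding smooth_on_def using Ck_on_bounded_bilinear[OF S] by blast

lemma smooth_on_add: "smooth_on f S \<Longrightarrow> smooth_on g S \<Longrightarrow> smooth_on (\<lambda>x. f x + g x) S"
  unfolding smooth_on_def using Ck_on_add[OF S] by blast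

lemma smooth_on_minus: "smooth_on f S \<Longrightarrow> smooth_on (\<lambda>x. - f x) S"
  by (rule smooth_on_bounded_linear[OF bounded_linear_minus[OF bounded_linear_ident]])

lemma smooth_on_diff: "smooth_on f S \<Longrightarrow> smooth_on g S \<Longrightarrow> smooth_on (\<lambda>x. f x - g x) S"
  using smooth_on_add[of f "\<lambda>x. - g x"] smooth_on_minus[of g] by simp

lemma smooth_on_vec_nth: "smooth_on f S \<Longrightarrow> smooth_on (\<lambda>x. f x $ i) S"
  by (rule smooth_on_bounded_linear[OF bounded_linear_vec_nth])

lemma smooth_on_scaleR: "smooth_on f S \<Longrightarrow> smooth_on g S \<Longrightarrow> smooth_on (\<lambda>x. f x *\<^sub>R g x) S"
  by (rule smooth_on_bounded_bilinear[OF bounded_bilinear_scaleR])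

lemma smooth_on_inner: "smooth_on f S \<Longrightarrow> smooth_on g S \<Longrightarrow> smooth_on (\<lambda>x. f x \<bullet> g x) S"
  by (rule smooth_on_bounded_bilinear[OF bounded_bilinear_inner])

lemma smooth_on_cross3: "smooth_on f S \<Longrightarrow> smooth_on g S \<Longrightarrow> smooth_on (\<lambda>x. f x \<times> g x) S"
  using bilinear_cross smooth_on_bounded_bilinear bilinear_conv_bounded_bilinear by blast

lemma smooth_on_mult:
  fixes f g :: "'a \<Rightarrow> real"
  shows "smooth_on f S \<Longrightarrow> smooth_on g S \<Longrightarrow> smooth_on (\<lambda>x. f x * g x) S"
  by (rule smooth_on_bounded_bilinear[OF bounded_bilinear_mult])

lemma smooth_on_power:
  fixes f :: "'a \<Rightarrow> real"
  shows "smooth_on f S \<Longrightarrow> smooth_on (\<lambda>x. f x ^ n) S"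
  by (induction n) (auto intro: smooth_on_mult smooth_on_const)

lemma smooth_on_inverse:
  fixes f :: "'a \<Rightarrow> real"
  shows "smooth_on f S \<Longrightarrow> (\<And>x. x \<in> S \<Longrightarrow> f x \<noteq> 0) \<Longrightarrow> smooth_on (\<lambda>x. inverse (f x)) S"
  unfolding smooth_on_def using Ck_on_inverse[OF S] by blast

lemma smooth_on_divide:
  fixes f g :: "'a \<Rightarrow> real"
  shows "smooth_on f S \<Longrightarrow> smooth_on g S \<Longrightarrow> (\<And>x. x \<in> S \<Longrightarrow> g x \<noteq> 0) \<Longrightarrow>
    smooth_on (\<lambda>x. f x / g x) S"
  unfolding divide_inverse by (intro smooth_on_mult smooth_on_inverse)

lemma smooth_on_sqrt:
  fixes f :: "'a \<Rightarrow> real"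
  shows "smooth_on f S \<Longrightarrow> (\<And>x. x \<in> S \<Longrightarrow> f x > 0) \<Longrightarrow> smooth_on (\<lambda>x. sqrt (f x)) S"
  unfolding smooth_on_def using Ck_on_sqrt[OF S] by blast

lemma smooth_on_norm:
  fixes f :: "'a \<Rightarrow> 'b::real_inner"
  shows "smooth_on f S \<Longrightarrow> (\<And>x. x \<in> S \<Longrightarrow> f x \<noteq> 0) \<Longrightarrow> smooth_on (\<lambda>x. norm (f x)) S"
  unfolding norm_eq_sqrt_inner by (intro smooth_on_sqrt smooth_on_inner) auto

end

section \<open>Symmetry of second derivatives\<close>

text \<open>The mean value theorem is applied to the second difference over a parallelogram, first
  in direction \<open>u\<close>, then in direction \<open>v\<close>. The left side is symmetric in
  \<open>u\<close> and \<open>v\<close>, which later forces the mixed derivatives to agree.\<close>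

lemma mixed_difference_mvt:
  fixes f :: "'a::euclidean_space \<Rightarrow> real"
  assumes f: "Ck_on 2 f (ball p d)" and t: "t > 0" and d: "t * (norm u + norm v) < d"
  obtains q where "q \<in> ball p d"
    "f (p + t *\<^sub>R u + t *\<^sub>R v) - f (p + t *\<^sub>R u) - f (p + t *\<^sub>R v) + f p =
      t\<^sup>2 * frechet_derivative (\<lambda>x. frechet_derivative f (at x) u) (at q) v"
proof -
  let ?f' = "\<lambda>x. frechet_derivative f (at x)"
  let ?f'' = "\<lambda>x. frechet_derivative (\<lambda>x. ?f' x u) (at x)"
  have f': "(f has_derivative ?f' x) (at x)" and f'': "((\<lambda>x. ?f' x u) has_derivative ?f'' x) (at x)"
    if "x \<in> ball p d" for x
    using f that by (auto simp: numeral_2_eq_2 simp flip: frechet_derivative_works)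
  have in_ball: "p + s *\<^sub>R u + r *\<^sub>R v \<in> ball p d" if "0 \<le> s" "s \<le> t" "0 \<le> r" "r \<le> t" for s r
  proof -
    have "norm (s *\<^sub>R u + r *\<^sub>R v) \<le> s * norm u + r * norm v"
      using that norm_triangle_ineq[of "s *\<^sub>R u" "r *\<^sub>R v"] by simp
    also have "\<dots> \<le> t * norm u + t * norm v"
      using that by (intro add_mono mult_right_mono) auto
    also have "\<dots> < d" using d by (simp add: algebra_simps)
    finally have "norm (s *\<^sub>R u + r *\<^sub>R v) < d" .
    moreover have "p - (p + s *\<^sub>R u + r *\<^sub>R v) = - (s *\<^sub>R u + r *\<^sub>R v)" by simp
    ultimately show ?thesis by (simp only: mem_ball dist_norm norm_minus_cancel)
  qed
  \<comment> \<open>The chain rule along a line gives the one-variable derivatives that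
    \<open>MVT2\<close> requires.\<close>
  have line: "((\<lambda>s. g (a + s *\<^sub>R w)) has_real_derivative g' w) (at s)"
    if "(g has_derivative g') (at (a + s *\<^sub>R w))" for g g' a w and s :: real
  proof -
    have *: "((\<lambda>s. a + s *\<^sub>R w) has_derivative (\<lambda>h. h *\<^sub>R w)) (at s)"
      by (auto intro!: derivative_eq_intros)
    have "((\<lambda>s. g (a + s *\<^sub>R w)) has_derivative (\<lambda>h. g' (h *\<^sub>R w))) (at s)"
      by (rule has_derivative_compose[OF * that])
    moreover have "linear g'" using that by (rule has_derivative_linear)
    ultimately show ?thesis
      by (simp add: has_field_derivative_def linear_cmul mult_commute_abs)
  qed
  \<comment> \<open>\<open>g s\<close> is the increment of \<open>f\<close> by \<open>t v\<close> at
    \<open>p + s u\<close>, so \<open>g t - g 0\<close> is the mixed second difference.\<close>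
  define g where "g s = f (p + t *\<^sub>R v + s *\<^sub>R u) - f (p + s *\<^sub>R u)" for s
  have "(g has_real_derivative ?f' (p + t *\<^sub>R v + s *\<^sub>R u) u - ?f' (p + s *\<^sub>R u) u) (at s)"
    if "0 \<le> s" "s \<le> t" for s
    unfolding g_def using that t in_ball[of s t] in_ball[of s 0]
    by (intro DERIV_diff line f') (auto simp: algebra_simps)
  from MVT2[OF t this] obtain s where s: "0 < s" "s < t"
    "g t - g 0 = t * (?f' (p + t *\<^sub>R v + s *\<^sub>R u) u - ?f' (p + s *\<^sub>R u) u)" by auto
  have "((\<lambda>r. ?f' (p + s *\<^sub>R u + r *\<^sub>R v) u) has_real_derivative ?f'' (p + s *\<^sub>R u + r *\<^sub>R v) v) (at r)"
    if "0 \<le> r" "r \<le> t" for r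
    using that s in_ball[of s r] by (intro line f'') auto
  from MVT2[OF t this] obtain r where r: "0 < r" "r < t"
    "?f' (p + s *\<^sub>R u + t *\<^sub>R v) u - ?f' (p + s *\<^sub>R u + 0 *\<^sub>R v) u = t * ?f'' (p + s *\<^sub>R u + r *\<^sub>R v) v"
    by auto
  have "g t - g 0 = t\<^sup>2 * ?f'' (p + s *\<^sub>R u + r *\<^sub>R v) v"
    using s(3) r(3) by (simp add: power2_eq_square algebra_simps)
  then show thesis
    using in_ball[of s r] s r by (intro that) (auto simp: g_def algebra_simps)
qed

text \<open>Schwarz's theorem: by continuity, distinct mixed derivatives would stay apart on a small
  ball, yet the common second difference yields points of that ball where their values
  coincide.\<close>

lemma frechet_derivative_symmetric_real:
  fixes f :: "'a::euclidean_space \<Rightarrow> real"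
  assumes "open S" "p \<in> S" and f: "Ck_on 2 f S"
  shows "frechet_derivative (\<lambda>x. frechet_derivative f (at x) u) (at p) v =
    frechet_derivative (\<lambda>x. frechet_derivative f (at x) v) (at p) u" (is "?D u v p = ?D v u p")
proof (rule ccontr)
  assume neq: "?D u v p \<noteq> ?D v u p"
  define e where "e = \<bar>?D u v p - ?D v u p\<bar> / 2"
  have e: "e > 0" using neq by (simp add: e_def)
  have cont: "continuous_on S (?D u v)" for u v
    using f by (auto simp: numeral_2_eq_2)
  have ex: "\<exists>d>0. \<forall>q\<in>ball p d. \<bar>?D u v q - ?D u v p\<bar> < e" for u v
  proof -
    have "isCont (?D u v) p"
      using cont assms(1,2) continuous_on_eq_continuous_at by blast
    then show ?thesis
      using e unfolding continuous_at_eps_delta by (auto simp: dist_real_def dist_commute ball_def)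
  qed
  obtain d1 d2 d3 where "d1 > 0" "d2 > 0" "d3 > 0" "ball p d3 \<subseteq> S"
    and d1: "\<And>q. q \<in> ball p d1 \<Longrightarrow> \<bar>?D u v q - ?D u v p\<bar> < e"
    and d2: "\<And>q. q \<in> ball p d2 \<Longrightarrow> \<bar>?D v u q - ?D v u p\<bar> < e"
    using ex[of u v] ex[of v u] assms(1,2) by (meson open_contains_ball)
  define d where "d = min d1 (min d2 d3)"
  have "d > 0" using \<open>d1 > 0\<close> \<open>d2 > 0\<close> \<open>d3 > 0\<close> by (simp add: d_def)
  have fd: "Ck_on 2 f (ball p d)"
    by (rule Ck_on_subset[OF f]) (use \<open>ball p d3 \<subseteq> S\<close> in \<open>auto simp: d_def\<close>)
  \<comment> \<open>The \<open>+ 1\<close> keeps the denominator positive even for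
    \<open>u = v = 0\<close> and makes the bound \<open>td\<close> strict.\<close>
  define t where "t = d / (norm u + norm v + 1)"
  have pos: "norm u + norm v + 1 > 0" by (simp add: add_nonneg_pos)
  have t: "t > 0" using pos \<open>d > 0\<close> by (simp add: t_def)
  have "t * (norm u + norm v) < t * (norm u + norm v + 1)" using t by simp
  also have "\<dots> = d" using pos by (simp add: t_def)
  finally have td: "t * (norm u + norm v) < d" .
  then have td': "t * (norm v + norm u) < d" by (simp add: add.commute)
  obtain a where a: "a \<in> ball p d"
    "f (p + t *\<^sub>R u + t *\<^sub>R v) - f (p + t *\<^sub>R u) - f (p + t *\<^sub>R v) + f p = t\<^sup>2 * ?D u v a"
    using mixed_difference_mvt[OF fd t td] by blast
  obtain b where b: "b \<in> ball p d"
    "f (p + t *\<^sub>R v + t *\<^sub>R u) - f (p + t *\<^sub>R v) - f (p + t *\<^sub>R u) + f p = t\<^sup>2 * ?D v u b"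
    using mixed_difference_mvt[OF fd t td'] by blast
  have "t\<^sup>2 * ?D u v a = t\<^sup>2 * ?D v u b"
    using a(2) b(2) by (simp add: algebra_simps)
  then have "?D u v a = ?D v u b" using t by simp
  moreover have "\<bar>?D u v a - ?D u v p\<bar> < e" "\<bar>?D v u b - ?D v u p\<bar> < e"
    using a(1) b(1) by (auto intro!: d1 d2 simp: d_def)
  \<comment> \<open>Each value moves by less than half the gap, so the two cannot meet.\<close>
  ultimately show False unfolding e_def by (simp add: abs_if split: if_splits)
qed

text \<open>Pairing with an arbitrary vector \<open>c\<close> reduces this to the real case, since
  inner products separate vectors.\<close>

lemma frechet_derivative_symmetric:
  fixes f :: "'a::euclidean_space \<Rightarrow> 'b::real_inner"
  assumes S: "open S" and p: "p \<in> S" and f: "smooth_on f S"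
  shows "frechet_derivative (\<lambda>x. frechet_derivative f (at x) u) (at p) v =
    frechet_derivative (\<lambda>x. frechet_derivative f (at x) v) (at p) u"
proof (rule vector_eq_ldot[THEN iffD1], rule allI)
  fix c :: 'b
  let ?g = "\<lambda>x. c \<bullet> f x"
  have inner: "frechet_derivative (\<lambda>x. c \<bullet> h x) (at x) w = c \<bullet> frechet_derivative h (at x) w"
    if "smooth_on h S" "x \<in> S" for h :: "'a \<Rightarrow> 'b" and x w
  proof -
    have "((\<lambda>x. c \<bullet> h x) has_derivative (\<lambda>w. c \<bullet> frechet_derivative h (at x) w)) (at x)"
      using smooth_on_imp_differentiable[OF that]
      by (intro has_derivative_inner_right) (simp flip: frechet_derivative_works)
    from frechet_derivative_at[OF this] show ?thesis by metis
  qed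
  have iter: "frechet_derivative (\<lambda>x. frechet_derivative ?g (at x) u) (at p) v =
      c \<bullet> frechet_derivative (\<lambda>x. frechet_derivative f (at x) u) (at p) v" for u v
  proof -
    note fu = smooth_on_frechet_derivative[OF f, of u]
    have "(\<lambda>x. c \<bullet> frechet_derivative f (at x) u) differentiable at p"
      by (intro smooth_on_imp_differentiable[OF _ p] smooth_on_inner smooth_on_const fu S)
    then have "frechet_derivative (\<lambda>x. c \<bullet> frechet_derivative f (at x) u) (at p) =
        frechet_derivative (\<lambda>x. frechet_derivative ?g (at x) u) (at p)"
      by (rule frechet_derivative_transform_within_open[OF _ S p]) (simp add: inner[OF f])
    then show ?thesis using inner[OF fu p] by metis
  qed
  have "Ck_on 2 ?g S"
    using smooth_on_inner[OF S smooth_on_const f] by (auto simp: smooth_on_def)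
  from frechet_derivative_symmetric_real[OF S p this, of u v]
  show "c \<bullet> frechet_derivative (\<lambda>x. frechet_derivative f (at x) u) (at p) v =
      c \<bullet> frechet_derivative (\<lambda>x. frechet_derivative f (at x) v) (at p) u"
    by (simp only: iter)
qed

section \<open>Tangent moving bases\<close>

lemma matrix_inv_cancel:
  fixes A :: "real^'n^'n"
  assumes "det A \<noteq> 0"
  shows "A ** matrix_inv A = mat 1" "matrix_inv A ** A = mat 1"
  using assms unfolding matrix_inv_def invertible_det_nz[symmetric] invertible_def
  by (metis (mono_tags, lifting) someI_ex)+

text \<open>Cramer's rule: \<open>matrix_inv\<close> is defined by choice, and this rational formula
  makes smoothness of its entries accessible.\<close>

lemma matrix_inv_2:
  fixes A :: "real^2^2"
  assumes "det A \<noteq> 0"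
  shows "matrix_inv A = (1 / det A) *\<^sub>R adjugate2 A"
proof -
  have "A ** ((1 / det A) *\<^sub>R adjugate2 A) = mat 1"
    using assms
    by (simp add: vec_eq_iff forall_2 matrix_matrix_mult_def sum_2 mat_def adjugate2_def det_2
        diff_divide_distrib[symmetric])
  then show ?thesis
    by (metis assms matrix_inv_cancel(2) matrix_mul_assoc matrix_mul_lid matrix_mul_rid)
qed

lemma jacobian_nth:
  fixes f :: "real^'n \<Rightarrow> real^'m"
  shows "jacobian f (at q) $ i $ j = frechet_derivative f (at q) (axis j 1) $ i"
  by (simp add: jacobian_def matrix_def)

lemma column_jacobian:
  fixes f :: "real^'n \<Rightarrow> real^'m"
  shows "column j (jacobian f (at q)) = frechet_derivative f (at q) (axis j 1)"
  by (simp add: vec_eq_iff column_def jacobian_nth)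

lemma smooth_on_jacobian:
  fixes f :: "real^'n \<Rightarrow> real^'m"
  assumes "open S" "smooth_on f S"
  shows "smooth_on (\<lambda>q. jacobian f (at q) $ i $ j) S"
  unfolding jacobian_nth by (intro smooth_on_vec_nth smooth_on_frechet_derivative assms)

lemma smooth_on_sum:
  assumes "open S" "\<And>i. i \<in> I \<Longrightarrow> smooth_on (f i) S"
  shows "smooth_on (\<lambda>x. \<Sum>i\<in>I. f i x) S"
  using assms(2)
  by (induction I rule: infinite_finite_induct) (auto intro: smooth_on_const smooth_on_add[OF \<open>open S\<close>])

lemma smooth_on_transpose:
  "(\<And>i j. smooth_on (\<lambda>q. A q $ i $ j) S) \<Longrightarrow> smooth_on (\<lambda>q. transpose (A q) $ i $ j) S"
  by (simp add: transpose_def)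

lemma smooth_on_matrix_mult:
  fixes A :: "_ \<Rightarrow> real^'k^'m" and B :: "_ \<Rightarrow> real^'n^'k"
  assumes "open S" "\<And>i j. smooth_on (\<lambda>q. A q $ i $ j) S" "\<And>i j. smooth_on (\<lambda>q. B q $ i $ j) S"
  shows "smooth_on (\<lambda>q. (A q ** B q) $ i $ j) S"
  using assms(2,3)
  by (simp add: matrix_matrix_mult_def smooth_on_sum[OF \<open>open S\<close>] smooth_on_mult[OF \<open>open S\<close>])

lemma smooth_on_matrix_inv_2:
  fixes A :: "_ \<Rightarrow> real^2^2"
  assumes S: "open S" and A: "\<And>i j. smooth_on (\<lambda>q. A q $ i $ j) S"
    and nz: "\<And>q. q \<in> S \<Longrightarrow> det (A q) \<noteq> 0"
  shows "smooth_on (\<lambda>q. matrix_inv (A q) $ i $ j) S"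
proof (subst smooth_on_cong[OF S])
  have det: "smooth_on (\<lambda>q. det (A q)) S"
    unfolding det_2 by (intro smooth_on_diff smooth_on_mult S A)
  have adj: "smooth_on (\<lambda>q. adjugate2 (A q) $ i $ j) S" for i j
    using exhaust_2[of i] exhaust_2[of j]
    by (auto simp: adjugate2_def intro!: smooth_on_minus S A)
  show "smooth_on (\<lambda>q. 1 / det (A q) * adjugate2 (A q) $ i $ j) S"
    using nz by (intro smooth_on_mult smooth_on_divide smooth_on_const S det adj) auto
qed (simp add: matrix_inv_2 nz)

section \<open>Linear algebra of a moving basis at a point\<close>

lemma tmb_cross_nonzero:
  assumes "tangent_moving_basis x U \<Omega>" "q \<in> U"
  shows "column 1 (\<Omega> q) \<times> column 2 (\<Omega> q) \<noteq> 0"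
proof
  let ?a = "column 1 (\<Omega> q)" and ?b = "column 2 (\<Omega> q)"
  have ind: "?a \<noteq> ?b" "independent {?a, ?b}"
    using assms by (auto simp: tangent_moving_basis_def)
  assume "?a \<times> ?b = 0"
  moreover have "?a \<noteq> 0" "?b \<noteq> 0" using ind(2) dependent_zero[of "{?a, ?b}"] by auto
  ultimately obtain c where "?b = c *\<^sub>R ?a" by (auto simp: cross_eq_0 collinear_lemma)
  \<comment> \<open>Removing \<open>?b\<close> keeps \<open>?a\<close> in the set because the two
    columns differ.\<close>
  moreover have "c *\<^sub>R ?a \<in> span ({?a, ?b} - {?b})"
    using ind(1) by (intro span_mul span_base) auto
  ultimately have "?b \<in> span ({?a, ?b} - {?b})" by metis
  with ind(2) show False by (auto simp: dependent_def)
qed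

lemma I_tmb_nth: "I_tmb \<Omega> q $ i $ j = column i (\<Omega> q) \<bullet> column j (\<Omega> q)"
  by (simp add: I_tmb_def matrix_matrix_mult_def transpose_def column_def inner_vec_def)

lemma I_tmb_sym: "transpose (I_tmb \<Omega> q) = I_tmb \<Omega> q"
  by (simp add: I_tmb_def matrix_transpose_mul)

text \<open>Lagrange's identity for the Gram determinant.\<close>

lemma det_I_tmb: "det (I_tmb \<Omega> q) = (norm (column 1 (\<Omega> q) \<times> column 2 (\<Omega> q)))\<^sup>2"
  by (simp add: det_2 I_tmb_nth power2_norm_eq_inner dot_cross inner_commute)

text \<open>These are the leading minors; together they express positive definiteness of the Gram
  matrix.\<close>

lemma I_tmb_pos:
  assumes "tangent_moving_basis x U \<Omega>" "q \<in> U"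
  shows "det (I_tmb \<Omega> q) > 0" "I_tmb \<Omega> q $ 1 $ 1 > 0"
  using tmb_cross_nonzero[OF assms] by (auto simp: det_I_tmb I_tmb_nth)

text \<open>The definition of \<open>mu_tmb\<close> can be solved for \<open>II_tmb\<close> because
  the inverse of the symmetric matrix \<open>I_tmb\<close> is symmetric.\<close>

lemma II_tmb_eq:
  assumes "det (I_tmb \<Omega> q) \<noteq> 0"
  shows "II_tmb \<Omega> q = - (I_tmb \<Omega> q ** transpose (mu_tmb \<Omega> q))"
proof -
  let ?I = "I_tmb \<Omega> q" and ?II = "II_tmb \<Omega> q"
  have "transpose (matrix_inv ?I) ** ?I = mat 1"
    using matrix_inv_cancel(1)[OF assms]
    by (metis I_tmb_sym matrix_transpose_mul transpose_mat)
  then have "transpose (matrix_inv ?I) = matrix_inv ?I"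
    using matrix_inv_cancel(1)[OF assms]
    by (metis matrix_mul_assoc matrix_mul_lid matrix_mul_rid)
  moreover have "transpose (mu_tmb \<Omega> q) = - transpose (transpose ?II ** matrix_inv ?I)"
    by (simp add: mu_tmb_def transpose_def vec_eq_iff)
  ultimately have "transpose (mu_tmb \<Omega> q) = - (matrix_inv ?I ** ?II)"
    by (simp add: matrix_transpose_mul)
  moreover have "?I ** - (matrix_inv ?I ** ?II) = - (?I ** (matrix_inv ?I ** ?II))"
    by (simp add: matrix_matrix_mult_def vec_eq_iff sum_negf)
  ultimately show ?thesis
    using assms by (simp add: matrix_mul_assoc matrix_inv_cancel)
qed

lemma tangent_column:
  assumes "tangent_moving_basis x U \<Omega>" "q \<in> U"
  obtains c d where
    "column j (jacobian x (at q)) = c *\<^sub>R column 1 (\<Omega> q) + d *\<^sub>R column 2 (\<Omega> q)"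
proof -
  have "column j (jacobian x (at q)) \<in> span {column 1 (\<Omega> q), column 2 (\<Omega> q)}"
    using assms exhaust_2[of j] by (auto simp: tangent_moving_basis_def)
  then obtain c d where
    "column j (jacobian x (at q)) - c *\<^sub>R column 1 (\<Omega> q) = d *\<^sub>R column 2 (\<Omega> q)"
    by (auto simp: span_insert[of "column 1 (\<Omega> q)"] span_singleton)
  then show thesis by (intro that[of c d]) (simp add: diff_eq_eq add.commute)
qed

text \<open>Tangency of the columns factors the Jacobian through \<Omega> with a coefficient matrix
  \<open>C\<close>. Inserted into \<open>Lambda_tmb\<close>, the Gram matrix cancels and the
  transpose of \<open>C\<close> remains.\<close>

lemma jacobian_eq_tmb:
  assumes "tangent_moving_basis x U \<Omega>" "q \<in> U"
  shows "jacobian x (at q) = \<Omega> q ** transpose (Lambda_tmb x \<Omega> q)"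
proof -
  let ?J = "jacobian x (at q)"
  obtain c d where cd: "\<And>j. column j ?J = c j *\<^sub>R column 1 (\<Omega> q) + d j *\<^sub>R column 2 (\<Omega> q)"
  proof -
    have "\<forall>j. \<exists>c d. column j ?J = c *\<^sub>R column 1 (\<Omega> q) + d *\<^sub>R column 2 (\<Omega> q)"
      by (meson tangent_column[OF assms])
    then show ?thesis using that by metis
  qed
  define C :: "real^2^2" where "C = (\<chi> i j. if i = 1 then c j else d j)"
  have J: "?J = \<Omega> q ** C"
    using cd by (simp add: vec_eq_iff column_def matrix_matrix_mult_def sum_2 C_def mult.commute)
  have "det (I_tmb \<Omega> q) \<noteq> 0" using I_tmb_pos[OF assms] by simp
  then have "Lambda_tmb x \<Omega> q = transpose C"
    by (simp add: Lambda_tmb_def J matrix_transpose_mul matrix_mul_assoc[symmetric] I_tmb_def[symmetric]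
        matrix_inv_cancel)
  then show ?thesis by (simp add: J)
qed

lemma fundamental_forms_eq_tmb:
  assumes "tangent_moving_basis x U \<Omega>" "q \<in> U"
  shows "first_fundamental_form x q =
      Lambda_tmb x \<Omega> q ** I_tmb \<Omega> q ** transpose (Lambda_tmb x \<Omega> q)" (is ?first)
    and "second_fundamental_form x \<Omega> q =
      - (Lambda_tmb x \<Omega> q ** I_tmb \<Omega> q ** transpose (mu_tmb \<Omega> q))" (is ?second)
proof -
  note J = jacobian_eq_tmb[OF assms]
  show ?first
    by (simp add: first_fundamental_form_def J matrix_transpose_mul I_tmb_def matrix_mul_assoc)
  have neg: "A ** - B = - (A ** B)" for A :: "real^2^2" and B :: "real^2^2"
    by (simp add: matrix_matrix_mult_def vec_eq_iff sum_negf)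
  have "second_fundamental_form x \<Omega> q = Lambda_tmb x \<Omega> q ** II_tmb \<Omega> q"
    by (simp add: second_fundamental_form_def II_tmb_def J matrix_transpose_mul matrix_mul_assoc neg)
  then show ?second
    using I_tmb_pos[OF assms] by (simp add: II_tmb_eq neg matrix_mul_assoc)
qed

text \<open>\<open>\<Omega> q\<close> is injective, since the invertible Gram matrix provides a left
  inverse. So the Jacobian is injective exactly when its square factor \<open>?L\<close> is.\<close>

lemma singular_set_iff_lambda_tmb:
  assumes "smooth_on x U" "tangent_moving_basis x U \<Omega>" "q \<in> U"
  shows "q \<in> singular_set x U \<longleftrightarrow> lambda_tmb x \<Omega> q = 0"
proof -
  let ?L = "transpose (Lambda_tmb x \<Omega> q)"
  have d: "x differentiable at q" using assms smooth_on_imp_differentiable by blast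
  then have "frechet_derivative x (at q) = (*v) (jacobian x (at q))"
    by (metis frechet_derivative_at jacobian_works)
  then have "frechet_derivative x (at q) = (*v) (\<Omega> q) \<circ> (*v) ?L"
    by (simp only: fun_eq_iff o_apply matrix_vector_mul_assoc jacobian_eq_tmb[OF assms(2,3)] simp_thms)
  moreover have "inj ((*v) (\<Omega> q))"
    using I_tmb_pos[OF assms(2,3)] matrix_inv_cancel(2)[of "I_tmb \<Omega> q"]
    unfolding I_tmb_def matrix_left_invertible_injective[symmetric]
    by (metis less_irrefl matrix_mul_assoc)
  ultimately have "inj (frechet_derivative x (at q)) \<longleftrightarrow> inj ((*v) ?L)"
    by (metis inj_compose inj_on_imageI2)
  also have "\<dots> \<longleftrightarrow> lambda_tmb x \<Omega> q \<noteq> 0"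
    by (simp add: det_nz_iff_inj[symmetric] lambda_tmb_def det_transpose)
  finally show ?thesis using d assms(3) by (simp add: singular_set_def immersive_at_def)
qed

section \<open>The unit normal and symmetry of the second fundamental form\<close>

lemma smooth_on_column:
  fixes A :: "_ \<Rightarrow> real^'n^'m"
  assumes "open S" "smooth_on A S"
  shows "smooth_on (\<lambda>q. column j (A q)) S"
  by (rule smooth_on_bounded_linear[OF assms(1) _ assms(2)])
    (simp add: linear_conv_bounded_linear[symmetric] linear_iff column_def vec_eq_iff)

lemma smooth_on_tmb_normal:
  assumes U: "open U" and \<Omega>: "tangent_moving_basis x U \<Omega>"
  shows "smooth_on (tmb_normal \<Omega>) U"
proof -
  have "smooth_on \<Omega> U" using \<Omega> by (simp add: tangent_moving_basis_def)
  then show ?thesis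
    unfolding tmb_normal_def Let_def
    by (intro smooth_on_scaleR smooth_on_divide smooth_on_norm smooth_on_cross3 smooth_on_column
        smooth_on_const U) (auto simp: tmb_cross_nonzero[OF \<Omega>])
qed

lemma tmb_normal_orthogonal:
  assumes "tangent_moving_basis x U \<Omega>" "q \<in> U"
  shows "frechet_derivative x (at q) (axis j 1) \<bullet> tmb_normal \<Omega> q = 0"
proof -
  let ?w = "column 1 (\<Omega> q) \<times> column 2 (\<Omega> q)"
  obtain c d where "column j (jacobian x (at q)) = c *\<^sub>R column 1 (\<Omega> q) + d *\<^sub>R column 2 (\<Omega> q)"
    using tangent_column[OF assms] .
  then have "column j (jacobian x (at q)) \<bullet> ?w = 0"
    by (simp add: dot_cross_self inner_add_left)
  then show ?thesis by (simp add: tmb_normal_def Let_def column_jacobian)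
qed

text \<open>Differentiating the orthogonality of the \<open>i\<close>-th partial derivative and the
  normal along coordinate \<open>j\<close> turns the entry into the normal component of a mixed
  second derivative, where Schwarz's theorem applies.\<close>

lemma second_fundamental_form_sym:
  assumes U: "open U" and x: "smooth_on x U" and \<Omega>: "tangent_moving_basis x U \<Omega>" and q: "q \<in> U"
  shows "second_fundamental_form x \<Omega> q $ i $ j = second_fundamental_form x \<Omega> q $ j $ i"
proof -
  let ?n = "tmb_normal \<Omega>"
  let ?x = "\<lambda>j q. frechet_derivative x (at q) (axis j 1)"
  have "second_fundamental_form x \<Omega> q $ i $ j =
      frechet_derivative (?x i) (at q) (axis j 1) \<bullet> ?n q" for i j :: 2
  proof -
    have "?n differentiable at q"
      using smooth_on_tmb_normal[OF U \<Omega>] q by (rule smooth_on_imp_differentiable)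
    moreover have "?x i differentiable at q"
      using smooth_on_frechet_derivative[OF x] q by (rule smooth_on_imp_differentiable)
    ultimately have "((\<lambda>r. ?x i r \<bullet> ?n r) has_derivative
        (\<lambda>h. ?x i q \<bullet> frechet_derivative ?n (at q) h + frechet_derivative (?x i) (at q) h \<bullet> ?n q)) (at q)"
      by (intro has_derivative_inner) (simp_all flip: frechet_derivative_works)
    moreover have "((\<lambda>r. ?x i r \<bullet> ?n r) has_derivative (\<lambda>h. 0)) (at q)"
      by (rule has_derivative_transform_within_open[OF has_derivative_const U q])
        (simp add: tmb_normal_orthogonal[OF \<Omega>])
    ultimately have "(\<lambda>h. ?x i q \<bullet> frechet_derivative ?n (at q) h +
        frechet_derivative (?x i) (at q) h \<bullet> ?n q) = (\<lambda>h. 0)"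
      by (rule has_derivative_unique)
    from fun_cong[OF this, of "axis j 1"]
    have "?x i q \<bullet> frechet_derivative ?n (at q) (axis j 1) +
        frechet_derivative (?x i) (at q) (axis j 1) \<bullet> ?n q = 0" .
    then show ?thesis
      by (simp add: second_fundamental_form_def matrix_matrix_mult_def transpose_def jacobian_nth
          inner_vec_def)
  qed
  then show ?thesis
    using frechet_derivative_symmetric[OF U q x, of "axis i 1" "axis j 1"] by simp
qed

section \<open>Pointwise algebra of the fundamental forms\<close>

text \<open>In the following three lemmas \<open>(a, b; c, d)\<close>, \<open>(i, j; j, k)\<close> and \<open>(p, q; r, s)\<close> are the entries of
  \<open>\<Lambda>\<close>, \<open>I\<close> and \<open>\<mu>\<close>; the hypothesis is the symmetry of \<open>\<Lambda> I \<mu>\<^sup>T\<close>.\<close>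

lemma form_identity_diag:
  fixes a b c d i j k p q r s :: real
  assumes "a * (i * r + j * s) + b * (j * r + k * s) = c * (i * p + j * q) + d * (j * p + k * q)"
  shows "(p * d - q * c - r * b + s * a) * (a * (i * p + j * q) + b * (j * p + k * q)) =
      (a * d - b * c) * (p * (i * p + j * q) + q * (j * p + k * q)) +
      (p * s - q * r) * (a * (i * a + j * b) + b * (j * a + k * b))"
    and "(p * d - q * c - r * b + s * a) * (c * (i * r + j * s) + d * (j * r + k * s)) =
      (a * d - b * c) * (r * (i * r + j * s) + s * (j * r + k * s)) +
      (p * s - q * r) * (c * (i * c + j * d) + d * (j * c + k * d))"
  using assms by algebra+

lemma form_identity_offdiag:
  fixes a b c d i j k p q r s :: real
  assumes "a * (i * r + j * s) + b * (j * r + k * s) = c * (i * p + j * q) + d * (j * p + k * q)"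
  shows "(p * d - q * c - r * b + s * a) * (a * (i * r + j * s) + b * (j * r + k * s)) =
    (a * d - b * c) * (p * (i * r + j * s) + q * (j * r + k * s)) +
    (p * s - q * r) * (a * (i * c + j * d) + b * (j * c + k * d))"
  using assms by algebra

lemma form_discriminant:
  fixes a b c d i j k p q r s :: real
  assumes "a * (i * r + j * s) + b * (j * r + k * s) = c * (i * p + j * q) + d * (j * p + k * q)"
    and "i > 0" "i * k - j * j > 0"
  shows "4 * ((a * d - b * c) * (p * s - q * r)) \<le> (p * d - q * c - r * b + s * a)\<^sup>2"
proof -
  \<comment> \<open>\<open>P = adj(\<Lambda>) \<mu>\<close> is self-adjoint for the positive definite form \<open>I\<close>, so its eigenvalues are real.\<close>
  define P12 where "P12 = d * q - b * s"
  define P21 where "P21 = a * r - c * p"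
  define e where "e = (d * p - b * r) - (a * s - c * q)"
  have sym: "e * j = P21 * i - P12 * k"
    using assms(1) unfolding e_def P12_def P21_def by (simp add: algebra_simps)
  have disc: "(p * d - q * c - r * b + s * a)\<^sup>2 - 4 * ((a * d - b * c) * (p * s - q * r)) = e\<^sup>2 + 4 * P12 * P21"
    unfolding e_def P12_def P21_def by (simp add: algebra_simps power2_eq_square)
  \<comment> \<open>Completing the square, with \<open>P21 * i\<close> eliminated by
    \<open>sym\<close>.\<close>
  have "i\<^sup>2 * (e\<^sup>2 + 4 * P12 * P21) = (i * e + 2 * P12 * j)\<^sup>2 + 4 * (i * k - j * j) * P12\<^sup>2"
    using sym by algebra
  also have "\<dots> \<ge> 0" using assms(3) by simp
  finally have "e\<^sup>2 + 4 * P12 * P21 \<ge> 0" using assms(2) by (simp add: zero_le_mult_iff)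
  with disc show ?thesis by linarith
qed

text \<open>The matrices stand for the values of \<Lambda>, the Gram matrix, \<mu>, and the second
  and first fundamental forms at one point, and \<open>h\<close> for \<open>H_tmb\<close>
  there.\<close>

context
  fixes L I m M E :: "real^2^2" and h :: real
  assumes I: "transpose I = I"
    and M: "M = - (L ** I ** transpose m)" "M $ 1 $ 2 = M $ 2 $ 1"
    and E: "E = L ** I ** transpose L"
    and h: "h = - (1/2) * trace (m ** adjugate2 L)"
begin

private lemma I_sym: "I $ 2 $ 1 = I $ 1 $ 2"
  using arg_cong[OF I, of "\<lambda>A. A $ 1 $ 2"] by (simp add: transpose_def)

private lemma triple_nth: "(A ** I ** transpose B) $ i $ j =
    A $ i $ 1 * (I $ 1 $ 1 * B $ j $ 1 + I $ 1 $ 2 * B $ j $ 2) +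
    A $ i $ 2 * (I $ 1 $ 2 * B $ j $ 1 + I $ 2 $ 2 * B $ j $ 2)" for A B :: "real^2^2"
  by (simp add: matrix_matrix_mult_def transpose_def sum_2 I_sym algebra_simps)

private lemma M_nth: "M $ i $ j = - (
    L $ i $ 1 * (I $ 1 $ 1 * m $ j $ 1 + I $ 1 $ 2 * m $ j $ 2) +
    L $ i $ 2 * (I $ 1 $ 2 * m $ j $ 1 + I $ 2 $ 2 * m $ j $ 2))"
  by (simp add: M(1) triple_nth)

private lemma twice_h: "2 * h = - (m $ 1 $ 1 * L $ 2 $ 2 - m $ 1 $ 2 * L $ 2 $ 1
    - m $ 2 $ 1 * L $ 1 $ 2 + m $ 2 $ 2 * L $ 1 $ 1)"
  unfolding h by (simp add: matrix_matrix_mult_def trace_def sum_2 adjugate2_def field_simps)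

private lemma M_sym:
  "L $ 1 $ 1 * (I $ 1 $ 1 * m $ 2 $ 1 + I $ 1 $ 2 * m $ 2 $ 2) +
    L $ 1 $ 2 * (I $ 1 $ 2 * m $ 2 $ 1 + I $ 2 $ 2 * m $ 2 $ 2) =
   L $ 2 $ 1 * (I $ 1 $ 1 * m $ 1 $ 1 + I $ 1 $ 2 * m $ 1 $ 2) +
    L $ 2 $ 2 * (I $ 1 $ 2 * m $ 1 $ 1 + I $ 2 $ 2 * m $ 1 $ 2)"
  using M(2) unfolding M_nth by (simp only: neg_equal_iff_equal)

lemma det_second_form: "det M = det L * det m * det I"
proof -
  have "det M = det (L ** I ** transpose m)" by (simp add: M(1) det_2)
  then show ?thesis by (simp add: det_mul det_transpose)
qed

lemma det_first_form: "det E = (det L)\<^sup>2 * det I"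
  unfolding E by (simp add: det_mul det_transpose power2_eq_square)

text \<open>The left side is the trace of \<open>adj(E) M\<close>. In it \<open>adj(L) L\<close> and
  \<open>adj(I) I\<close> collapse to determinants, leaving the trace of \<open>m adj(L)\<close>,
  which is \<open>-2 h\<close>.\<close>

lemma trace_second_form:
  "M $ 1 $ 1 * E $ 2 $ 2 + M $ 2 $ 2 * E $ 1 $ 1 - 2 * M $ 1 $ 2 * E $ 1 $ 2 = 2 * det L * h * det I"
proof -
  have "M $ 1 $ 1 * E $ 2 $ 2 + M $ 2 $ 2 * E $ 1 $ 1 - M $ 1 $ 2 * E $ 1 $ 2 - M $ 2 $ 1 * E $ 1 $ 2
      = det L * (2 * h) * det I"
    unfolding twice_h E M_nth triple_nth det_2 I_sym by (simp add: algebra_simps)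
  then show ?thesis by (simp add: M(2) algebra_simps)
qed

text \<open>For \<open>C = m adj(L)\<close>, symmetry of \<open>M\<close> gives
  \<open>C E = - det L M\<close> and \<open>C C E = (det L)^2 m I m^T\<close>. Multiplying the
  Cayley-Hamilton equation of \<open>C\<close> by \<open>E\<close> and cancelling
  \<open>det L\<close> yields the identity; the entrywise polynomial proof also covers
  \<open>det L = 0\<close>, hence singular points.\<close>

lemma second_form_identity:
  "2 * h * M $ i $ j = det L * (m ** I ** transpose m) $ i $ j + det m * E $ i $ j"
proof -
  let ?P = "\<lambda>i j. 2 * h * M $ i $ j = det L * (m ** I ** transpose m) $ i $ j + det m * E $ i $ j"
  have "?P 1 1"
    unfolding twice_h E M_nth triple_nth det_2 minus_mult_minus
    by (rule form_identity_diag(1)[OF M_sym])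
  moreover have "?P 2 2"
    unfolding twice_h E M_nth triple_nth det_2 minus_mult_minus
    by (rule form_identity_diag(2)[OF M_sym])
  moreover have P12: "?P 1 2"
    unfolding twice_h E M_nth triple_nth det_2 minus_mult_minus
    by (rule form_identity_offdiag[OF M_sym])
  \<comment> \<open>All three matrices are symmetric, so this entry repeats the (1,2) one.\<close>
  moreover have "?P 2 1"
  proof -
    have "E $ 2 $ 1 = E $ 1 $ 2" "(m ** I ** transpose m) $ 2 $ 1 = (m ** I ** transpose m) $ 1 $ 2"
      unfolding E triple_nth by (simp_all add: algebra_simps)
    then show ?thesis using P12 M(2) by simp
  qed
  ultimately show ?thesis using exhaust_2[of i] exhaust_2[of j] by auto
qed

text \<open>This makes the radicand of the relative principal curvatures nonnegative, also at
  singular points.\<close>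

lemma discriminant_nonneg:
  assumes "I $ 1 $ 1 > 0" "det I > 0"
  shows "det L * det m \<le> h\<^sup>2"
proof -
  have "I $ 1 $ 1 * I $ 2 $ 2 - I $ 1 $ 2 * I $ 1 $ 2 > 0" using assms(2) by (simp add: det_2 I_sym)
  from form_discriminant[OF M_sym assms(1) this]
  have "4 * (det L * det m) \<le> (- (2 * h))\<^sup>2"
    unfolding twice_h det_2 minus_minus .
  then show ?thesis by (simp add: power_mult_distrib)
qed

end

section \<open>Divisibility by \<open>\<lambda>\<^sub>\<Omega>\<close>\<close>

lemma open_Collect_nonzero:
  fixes f :: "'a::topological_space \<Rightarrow> real"
  assumes "open V" "continuous_on V f"
  shows "open {r\<in>V. f r \<noteq> 0}"
proof -
  have "{r\<in>V. f r \<noteq> 0} = V \<inter> f -` (- {0})" by auto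
  with continuous_open_preimage[OF assms(2,1), of "- {0}"] show ?thesis
    by (simp add: open_Compl)
qed

lemma open_Collect_positive:
  fixes f :: "'a::topological_space \<Rightarrow> real"
  assumes "open V" "continuous_on V f"
  shows "open {r\<in>V. f r > 0}"
proof -
  have "{r\<in>V. f r > 0} = V \<inter> f -` {0<..}" by auto
  with continuous_open_preimage[OF assms(2,1), of "{0<..}"] show ?thesis by simp
qed

text \<open>Away from the zeros of \<open>g\<close> the factor equals \<open>h / g\<close> and is
  smooth automatically, so only the zeros of \<open>g\<close> have to be examined.\<close>

lemma smooth_principal_idealI:
  fixes g h \<phi> :: "'a::euclidean_space \<Rightarrow> real"
  assumes V: "open V" and g: "smooth_on g V" and h: "smooth_on h V"
    and eq: "\<And>q. q \<in> V \<Longrightarrow> h q = \<phi> q * g q"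
    and \<phi>: "\<And>q. q \<in> V \<Longrightarrow> g q = 0 \<Longrightarrow> \<exists>T. open T \<and> q \<in> T \<and> smooth_on \<phi> T"
  shows "h \<in> smooth_principal_ideal V g"
proof -
  have "smooth_on \<phi> V"
  proof (rule smooth_on_local)
    fix q assume q: "q \<in> V"
    show "\<exists>T. open T \<and> q \<in> T \<and> smooth_on \<phi> T"
    proof (cases "g q = 0")
      case False
      let ?T = "{r\<in>V. g r \<noteq> 0}"
      have T: "open ?T"
        by (intro open_Collect_nonzero V smooth_on_imp_continuous_on g)
      have "smooth_on (\<lambda>r. h r / g r) ?T"
        by (intro smooth_on_divide T smooth_on_subset[OF g] smooth_on_subset[OF h]) auto
      then have "smooth_on \<phi> ?T"
        by (subst smooth_on_cong[OF T, of _ "\<lambda>r. h r / g r"]) (auto simp: eq)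
      with T False q show ?thesis by blast
    qed (use \<phi> q in blast)
  qed
  with eq show ?thesis by (auto simp: smooth_principal_ideal_def)
qed

text \<open>The set where \<open>f\<close> and \<open>g\<close> differ is open and contained in the
  singular set, whose interior is empty.\<close>

lemma proper_on_eq_on:
  fixes f g :: "real^2 \<Rightarrow> real"
  assumes proper: "proper_on x U" and V: "open V"
    and "continuous_on V f" "continuous_on V g"
    and eq: "\<And>q. q \<in> V \<Longrightarrow> q \<notin> singular_set x U \<Longrightarrow> f q = g q"
    and q: "q \<in> V"
  shows "f q = g q"
proof (rule ccontr)
  assume neq: "f q \<noteq> g q"
  let ?T = "{r\<in>V. f r - g r \<noteq> 0}"
  have "open ?T"
    by (intro open_Collect_nonzero continuous_on_diff assms)
  moreover have "?T \<subseteq> singular_set x U" using eq by auto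
  ultimately have "?T \<subseteq> interior (singular_set x U)" by (rule interior_maximal[rotated])
  with proper neq q show False by (auto simp: proper_on_def)
qed

context
  fixes x :: "real^2 \<Rightarrow> real^3" and \<Omega> :: "real^2 \<Rightarrow> real^2^3" and U :: "(real^2) set"
  assumes U: "open U" and x: "smooth_on x U" and \<Omega>: "tangent_moving_basis x U \<Omega>"
begin

section \<open>Smoothness of the invariants of a moving basis\<close>

lemma smooth_on_I_tmb: "smooth_on (\<lambda>q. I_tmb \<Omega> q $ i $ j) U"
proof -
  have "smooth_on \<Omega> U" using \<Omega> by (simp add: tangent_moving_basis_def)
  then show ?thesis unfolding I_tmb_nth by (intro smooth_on_inner smooth_on_column U)
qed

lemma smooth_on_inv_I_tmb: "smooth_on (\<lambda>q. matrix_inv (I_tmb \<Omega> q) $ i $ j) U"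
  using I_tmb_pos(1)[OF \<Omega>] by (intro smooth_on_matrix_inv_2 U smooth_on_I_tmb) (metis less_irrefl)

lemma smooth_on_moving_basis_nth: "smooth_on (\<lambda>q. \<Omega> q $ i $ j) U"
  using \<Omega> by (intro smooth_on_vec_nth U) (simp add: tangent_moving_basis_def)

lemma smooth_on_mu_tmb: "smooth_on (\<lambda>q. mu_tmb \<Omega> q $ i $ j) U"
  unfolding mu_tmb_def II_tmb_def vector_uminus_component
  \<comment> \<open>The minus sign inside \<open>II_tmb\<close> surfaces only after the product and
    transpose rules, hence the repeated unfolding.\<close>
  by (intro smooth_on_minus smooth_on_matrix_mult smooth_on_transpose smooth_on_inv_I_tmb
      smooth_on_jacobian smooth_on_moving_basis_nth smooth_on_tmb_normal[OF U \<Omega>] U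
      | unfold vector_uminus_component)+

lemma smooth_on_Lambda_tmb: "smooth_on (\<lambda>q. Lambda_tmb x \<Omega> q $ i $ j) U"
  unfolding Lambda_tmb_def
  by (intro smooth_on_matrix_mult smooth_on_transpose smooth_on_inv_I_tmb
      smooth_on_jacobian smooth_on_moving_basis_nth x U)

lemma smooth_on_first_fundamental_form: "smooth_on (\<lambda>q. first_fundamental_form x q $ i $ j) U"
  unfolding first_fundamental_form_def
  by (intro smooth_on_matrix_mult smooth_on_transpose smooth_on_jacobian x U)

lemma smooth_on_second_fundamental_form:
  "smooth_on (\<lambda>q. second_fundamental_form x \<Omega> q $ i $ j) U"
  unfolding second_fundamental_form_def vector_uminus_component
  by (intro smooth_on_minus smooth_on_matrix_mult smooth_on_transpose smooth_on_jacobian x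
      smooth_on_tmb_normal[OF U \<Omega>] U)

text \<open>This matrix is the third fundamental form, the Gram matrix of the derivative of the
  normal; it enters through \<open>second_form_identity\<close>.\<close>

lemma smooth_on_third_form:
  "smooth_on (\<lambda>q. (mu_tmb \<Omega> q ** I_tmb \<Omega> q ** transpose (mu_tmb \<Omega> q)) $ i $ j) U"
  by (intro smooth_on_matrix_mult smooth_on_transpose smooth_on_mu_tmb smooth_on_I_tmb U)

lemma smooth_on_lambda_tmb: "smooth_on (lambda_tmb x \<Omega>) U"
  unfolding lambda_tmb_def[abs_def] det_2
  by (intro smooth_on_diff smooth_on_mult smooth_on_Lambda_tmb U)

lemma smooth_on_K_tmb: "smooth_on (K_tmb \<Omega>) U"
  unfolding K_tmb_def[abs_def] det_2
  by (intro smooth_on_diff smooth_on_mult smooth_on_mu_tmb U)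

lemma smooth_on_det_I_tmb: "smooth_on (\<lambda>q. det (I_tmb \<Omega> q)) U"
  unfolding det_2 by (intro smooth_on_diff smooth_on_mult smooth_on_I_tmb U)

lemma smooth_on_H_tmb: "smooth_on (H_tmb x \<Omega>) U"
proof -
  have adj: "smooth_on (\<lambda>q. adjugate2 (Lambda_tmb x \<Omega> q) $ i $ j) U" for i j
    using exhaust_2[of i] exhaust_2[of j]
    by (auto simp: adjugate2_def intro!: smooth_on_minus U smooth_on_Lambda_tmb)
  show ?thesis
    unfolding H_tmb_def[abs_def] trace_def
    by (intro smooth_on_mult smooth_on_const smooth_on_sum smooth_on_matrix_mult smooth_on_mu_tmb
        adj U)
qed

section \<open>Curvatures expressed by relative curvatures\<close>

lemmas tmb_pointwise =
  fundamental_forms_eq_tmb[OF \<Omega>] second_fundamental_form_sym[OF U x \<Omega>] I_tmb_pos[OF \<Omega>]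

lemma lambda_K_le_H_squared:
  assumes "q \<in> U"
  shows "lambda_tmb x \<Omega> q * K_tmb \<Omega> q \<le> (H_tmb x \<Omega> q)\<^sup>2"
  unfolding lambda_tmb_def K_tmb_def
  by (rule discriminant_nonneg[OF I_tmb_sym tmb_pointwise(2)[OF assms] tmb_pointwise(3)[OF assms]
        refl H_tmb_def tmb_pointwise(5)[OF assms] tmb_pointwise(4)[OF assms]])

lemma det_fundamental_forms:
  assumes "q \<in> U"
  shows "coeff_e x \<Omega> q * coeff_g x \<Omega> q - (coeff_f x \<Omega> q)\<^sup>2 =
      lambda_tmb x \<Omega> q * K_tmb \<Omega> q * det (I_tmb \<Omega> q)"
    and "coeff_E x q * coeff_G x q - (coeff_F x q)\<^sup>2 = (lambda_tmb x \<Omega> q)\<^sup>2 * det (I_tmb \<Omega> q)"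
proof -
  note second = tmb_pointwise(2)[OF assms]
    and sym = tmb_pointwise(3)[OF assms, of 1 2] and first = tmb_pointwise(1)[OF assms]
  show "coeff_e x \<Omega> q * coeff_g x \<Omega> q - (coeff_f x \<Omega> q)\<^sup>2 =
      lambda_tmb x \<Omega> q * K_tmb \<Omega> q * det (I_tmb \<Omega> q)"
    \<comment> \<open>The two \<open>refl\<close> instantiate \<open>E\<close> and \<open>h\<close>
      by their defining terms.\<close>
    using det_second_form[OF I_tmb_sym second sym refl refl] sym
    by (simp add: coeff_e_def coeff_f_def coeff_g_def lambda_tmb_def K_tmb_def
        det_2[of "second_fundamental_form x \<Omega> q"] power2_eq_square)
  have "first_fundamental_form x q $ 2 $ 1 = first_fundamental_form x q $ 1 $ 2"
    by (simp add: first_fundamental_form_def matrix_matrix_mult_def transpose_def mult.commute)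
  then show "coeff_E x q * coeff_G x q - (coeff_F x q)\<^sup>2 = (lambda_tmb x \<Omega> q)\<^sup>2 * det (I_tmb \<Omega> q)"
    using det_first_form[OF I_tmb_sym second sym first refl]
    by (simp add: coeff_E_def coeff_F_def coeff_G_def lambda_tmb_def
        det_2[of "first_fundamental_form x q"] power2_eq_square)
qed

text \<open>No regularity is assumed: at singular points both sides are divisions by zero, hence
  0.\<close>

lemma gauss_curvature_eq_tmb:
  assumes "q \<in> U"
  shows "gauss_curvature x \<Omega> q = K_tmb \<Omega> q / lambda_tmb x \<Omega> q"
  using I_tmb_pos(1)[OF \<Omega> assms] unfolding gauss_curvature_def det_fundamental_forms[OF assms]
  by (simp add: power2_eq_square)

lemma mean_curvature_eq_tmb:
  assumes "q \<in> U"
  shows "mean_curvature x \<Omega> q = H_tmb x \<Omega> q / lambda_tmb x \<Omega> q"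
proof -
  note second = tmb_pointwise(2)[OF assms]
    and sym = tmb_pointwise(3)[OF assms, of 1 2] and first = tmb_pointwise(1)[OF assms]
  have "coeff_e x \<Omega> q * coeff_G x q + coeff_g x \<Omega> q * coeff_E x q - 2 * coeff_f x \<Omega> q * coeff_F x q =
      2 * lambda_tmb x \<Omega> q * H_tmb x \<Omega> q * det (I_tmb \<Omega> q)"
    using trace_second_form[OF I_tmb_sym second sym first H_tmb_def]
    by (simp add: coeff_e_def coeff_f_def coeff_g_def coeff_E_def coeff_F_def coeff_G_def lambda_tmb_def)
  then show ?thesis
    using I_tmb_pos(1)[OF \<Omega> assms] unfolding mean_curvature_def det_fundamental_forms[OF assms]
    by (simp add: power2_eq_square)
qed

text \<open>Dividing the root by \<lambda> produces the absolute value of \<lambda>; the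
  sign-dependent labelling in \<open>principal_curvature\<close> compensates for it.\<close>

lemma principal_curvature_eq_tmb:
  assumes "q \<in> U" "lambda_tmb x \<Omega> q \<noteq> 0"
  shows "principal_curvature i x \<Omega> q = relative_principal_curvature i x \<Omega> q / lambda_tmb x \<Omega> q"
proof -
  let ?l = "lambda_tmb x \<Omega> q" and ?H = "H_tmb x \<Omega> q" and ?K = "K_tmb \<Omega> q"
  have "(?H / ?l)\<^sup>2 - ?K / ?l = (?H\<^sup>2 - ?l * ?K) / ?l\<^sup>2"
    using assms(2) by (simp add: field_simps power2_eq_square)
  then have "sqrt ((?H / ?l)\<^sup>2 - ?K / ?l) = sqrt (?H\<^sup>2 - ?l * ?K) / \<bar>?l\<bar>"
    by (simp add: real_sqrt_divide)
  then show ?thesis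
    using assms(2)
    by (auto simp: principal_curvature_def relative_principal_curvature_def Let_def
        gauss_curvature_eq_tmb[OF assms(1)] mean_curvature_eq_tmb[OF assms(1)]
        add_divide_distrib diff_divide_distrib)
qed

text \<open>A difference of squares; \<open>lambda_K_le_H_squared\<close> ensures that squaring the
  root returns the radicand.\<close>

lemma relative_principal_curvature_mult:
  assumes "q \<in> U" "{i, j} = {1, 2}"
  shows "relative_principal_curvature i x \<Omega> q * relative_principal_curvature j x \<Omega> q =
    lambda_tmb x \<Omega> q * K_tmb \<Omega> q"
proof -
  let ?H = "H_tmb x \<Omega> q" and ?s = "sqrt ((H_tmb x \<Omega> q)\<^sup>2 - lambda_tmb x \<Omega> q * K_tmb \<Omega> q)"
  have "(?H - ?s) * (?H + ?s) = ?H\<^sup>2 - ?s\<^sup>2"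
    by (simp add: algebra_simps power2_eq_square)
  also have "\<dots> = lambda_tmb x \<Omega> q * K_tmb \<Omega> q"
    using lambda_K_le_H_squared[OF assms(1)] by simp
  finally have "(?H - ?s) * (?H + ?s) = lambda_tmb x \<Omega> q * K_tmb \<Omega> q" .
  moreover have "i = 1 \<and> j = 2 \<or> i = 2 \<and> j = 1"
    using assms(2) by (auto simp: doubleton_eq_iff)
  ultimately show ?thesis
    by (auto simp: relative_principal_curvature_def Let_def mult.commute)
qed

lemma continuous_on_relative_principal_curvature:
  "continuous_on U (relative_principal_curvature i x \<Omega>)"
proof -
  have "continuous_on U (\<lambda>q. sqrt ((H_tmb x \<Omega> q)\<^sup>2 - lambda_tmb x \<Omega> q * K_tmb \<Omega> q))"
    by (intro continuous_on_real_sqrt continuous_on_diff continuous_on_power continuous_on_mult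
        smooth_on_imp_continuous_on smooth_on_H_tmb smooth_on_K_tmb smooth_on_lambda_tmb)
  then show ?thesis
    unfolding relative_principal_curvature_def[abs_def] Let_def
    using smooth_on_imp_continuous_on[OF smooth_on_H_tmb]
    by (cases "i = 1") (auto intro: continuous_on_diff continuous_on_add)
qed

text \<open>At a singular point the radicand is the square of \<open>H_tmb\<close>, which is
  positive, so it stays positive nearby and the root is smooth.\<close>

lemma smooth_relative_principal_curvature:
  assumes q: "q \<in> U" and sing: "lambda_tmb x \<Omega> q = 0" and H: "H_tmb x \<Omega> q \<noteq> 0"
  obtains T where "open T" "q \<in> T" "T \<subseteq> U" "smooth_on (relative_principal_curvature i x \<Omega>) T"
proof -
  let ?D = "\<lambda>q. (H_tmb x \<Omega> q)\<^sup>2 - lambda_tmb x \<Omega> q * K_tmb \<Omega> q"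
  define T where "T = {r\<in>U. ?D r > 0}"
  have D: "smooth_on ?D U"
    by (intro smooth_on_diff smooth_on_mult smooth_on_power smooth_on_H_tmb smooth_on_K_tmb
        smooth_on_lambda_tmb U)
  have T: "open T"
    unfolding T_def by (intro open_Collect_positive U smooth_on_imp_continuous_on D)
  have sq: "smooth_on (\<lambda>q. sqrt (?D q)) T"
    by (intro smooth_on_sqrt T smooth_on_subset[OF D]) (auto simp: T_def)
  have "smooth_on (H_tmb x \<Omega>) T"
    by (rule smooth_on_subset[OF smooth_on_H_tmb]) (auto simp: T_def)
  with sq have "smooth_on (relative_principal_curvature i x \<Omega>) T"
    unfolding relative_principal_curvature_def[abs_def] Let_def
    by (cases "i = 1") (auto intro: smooth_on_add[OF T] smooth_on_diff[OF T])
  then show thesis using T q sing H by (intro that[of T]) (auto simp: T_def)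
qed

text \<open>At a singular point the root is the absolute value of \<open>H_tmb\<close>, so both
  relative principal curvatures would vanish with it.\<close>

lemma H_tmb_nonzero:
  assumes "relative_principal_curvature i x \<Omega> q \<noteq> 0" "lambda_tmb x \<Omega> q = 0"
  shows "H_tmb x \<Omega> q \<noteq> 0"
  using assms by (auto simp: relative_principal_curvature_def Let_def split: if_splits)

section \<open>The equivalences\<close>

lemma K_tmb_ideal_iff_gauss_curvature_extends:
  assumes proper: "proper_on x U" and V: "open V" "V \<subseteq> U"
  shows "(\<exists>K. smooth_on K V \<and> (\<forall>q\<in>V - singular_set x U. K q = gauss_curvature x \<Omega> q)) \<longleftrightarrow>
    K_tmb \<Omega> \<in> smooth_principal_ideal V (lambda_tmb x \<Omega>)"
proof -
  \<comment> \<open>Clearing the denominator shows that a smooth extension of the Gaussian curvature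
    and a cofactor of \<lambda> are the same function; density carries the equation to singular
    points.\<close>
  have iff: "K q = gauss_curvature x \<Omega> q \<longleftrightarrow> K_tmb \<Omega> q = K q * lambda_tmb x \<Omega> q"
    if "q \<in> V" "q \<notin> singular_set x U" for K q
    using that V(2) singular_set_iff_lambda_tmb[OF x \<Omega>, of q]
    by (auto simp: gauss_curvature_eq_tmb field_simps)
  have "K_tmb \<Omega> q = K q * lambda_tmb x \<Omega> q"
    if K: "smooth_on K V" and ext: "\<forall>q\<in>V - singular_set x U. K q = gauss_curvature x \<Omega> q"
      and q: "q \<in> V" for K q
  proof (rule proper_on_eq_on[OF proper V(1) _ _ _ q])
    show "continuous_on V (K_tmb \<Omega>)"
      using smooth_on_K_tmb V(2) by (blast intro: smooth_on_imp_continuous_on smooth_on_subset)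
    show "continuous_on V (\<lambda>q. K q * lambda_tmb x \<Omega> q)"
      using smooth_on_lambda_tmb V(2) K
      by (blast intro: smooth_on_imp_continuous_on smooth_on_subset continuous_on_mult)
  qed (use iff ext in blast)
  then show ?thesis
    using iff unfolding smooth_principal_ideal_def by blast
qed

text \<open>At regular points this is the product formula divided by \<lambda>. Continuity of both
  sides extends it to \<open>V\<close>.\<close>

lemma K_tmb_eq_relative_mult:
  assumes proper: "proper_on x U" and V: "open V" "V \<subseteq> U"
    and ij: "{i, j} = {1, 2}"
    and kj: "smooth_on kj V" "\<forall>q\<in>V - singular_set x U. kj q = principal_curvature j x \<Omega> q"
    and q: "q \<in> V"
  shows "relative_principal_curvature i x \<Omega> q * kj q = K_tmb \<Omega> q"
proof (rule proper_on_eq_on[OF proper V(1) _ _ _ q])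
  show "continuous_on V (\<lambda>q. relative_principal_curvature i x \<Omega> q * kj q)"
    using continuous_on_relative_principal_curvature V(2) kj(1)
    by (blast intro: smooth_on_imp_continuous_on continuous_on_subset continuous_on_mult)
  show "continuous_on V (K_tmb \<Omega>)"
    using smooth_on_K_tmb V(2) by (blast intro: smooth_on_imp_continuous_on smooth_on_subset)
next
  fix r assume r: "r \<in> V" "r \<notin> singular_set x U"
  then have "r \<in> U" "lambda_tmb x \<Omega> r \<noteq> 0"
    using V(2) singular_set_iff_lambda_tmb[OF x \<Omega>, of r] by auto
  then show "relative_principal_curvature i x \<Omega> r * kj r = K_tmb \<Omega> r"
    using kj(2) r relative_principal_curvature_mult[OF \<open>r \<in> U\<close> ij]
    by (simp add: principal_curvature_eq_tmb)
qed

text \<open>By \<open>eq\<close> the two functions differ by the nonvanishing factor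
  \<open>?k\<close>. It is known to be smooth only near singular points (\<open>near\<close>), which
  is what \<open>smooth_principal_idealI\<close> asks for.\<close>

lemma K_tmb_ideal_iff_principal_curvature:
  assumes proper: "proper_on x U" and V: "open V" "V \<subseteq> U"
    and ij: "{i, j} = {1, 2}"
    and ki: "\<forall>q\<in>V. relative_principal_curvature i x \<Omega> q \<noteq> 0"
    and kj: "smooth_on kj V" "\<forall>q\<in>V - singular_set x U. kj q = principal_curvature j x \<Omega> q"
  shows "K_tmb \<Omega> \<in> smooth_principal_ideal V (lambda_tmb x \<Omega>) \<longleftrightarrow>
    kj \<in> smooth_principal_ideal V (lambda_tmb x \<Omega>)"
proof -
  let ?k = "relative_principal_curvature i x \<Omega>"
  note eq = K_tmb_eq_relative_mult[OF proper V ij kj]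
  have smooth: "smooth_on (lambda_tmb x \<Omega>) V" "smooth_on (K_tmb \<Omega>) V"
    using smooth_on_lambda_tmb smooth_on_K_tmb smooth_on_subset V(2) by blast+
  have near: "\<exists>T. open T \<and> q \<in> T \<and> T \<subseteq> V \<and> smooth_on ?k T"
    if q: "q \<in> V" and sing: "lambda_tmb x \<Omega> q = 0" for q
  proof -
    have "q \<in> U" using q V(2) by blast
    then obtain T where "open T" "q \<in> T" "T \<subseteq> U" "smooth_on ?k T"
      using smooth_relative_principal_curvature sing H_tmb_nonzero ki q by metis
    then show ?thesis
      using V(1) q by (intro exI[of _ "T \<inter> V"]) (auto intro: smooth_on_subset)
  qed
  show ?thesis
  proof
    assume "K_tmb \<Omega> \<in> smooth_principal_ideal V (lambda_tmb x \<Omega>)"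
    then obtain \<phi> where \<phi>: "smooth_on \<phi> V" "\<And>q. q \<in> V \<Longrightarrow> K_tmb \<Omega> q = \<phi> q * lambda_tmb x \<Omega> q"
      by (auto simp: smooth_principal_ideal_def)
    show "kj \<in> smooth_principal_ideal V (lambda_tmb x \<Omega>)"
    proof (rule smooth_principal_idealI[OF V(1) smooth(1) kj(1), of "\<lambda>q. \<phi> q / ?k q"])
      show "kj q = \<phi> q / ?k q * lambda_tmb x \<Omega> q" if "q \<in> V" for q
        using eq[OF that] \<phi>(2)[OF that] ki that by (simp add: field_simps)
      show "\<exists>T. open T \<and> q \<in> T \<and> smooth_on (\<lambda>q. \<phi> q / ?k q) T"
        if sing: "q \<in> V" "lambda_tmb x \<Omega> q = 0" for q
      proof -
        obtain T where T: "open T" "q \<in> T" "T \<subseteq> V" "smooth_on ?k T"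
          using near[OF sing] by blast
        then have "smooth_on (\<lambda>q. \<phi> q / ?k q) T"
          using ki by (intro smooth_on_divide smooth_on_subset[OF \<phi>(1)]) auto
        with T show ?thesis by blast
      qed
    qed
  next
    assume "kj \<in> smooth_principal_ideal V (lambda_tmb x \<Omega>)"
    then obtain \<psi> where \<psi>: "smooth_on \<psi> V" "\<And>q. q \<in> V \<Longrightarrow> kj q = \<psi> q * lambda_tmb x \<Omega> q"
      by (auto simp: smooth_principal_ideal_def)
    show "K_tmb \<Omega> \<in> smooth_principal_ideal V (lambda_tmb x \<Omega>)"
    proof (rule smooth_principal_idealI[OF V(1) smooth, of "\<lambda>q. ?k q * \<psi> q"])
      show "K_tmb \<Omega> q = ?k q * \<psi> q * lambda_tmb x \<Omega> q" if "q \<in> V" for q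
        using eq[OF that] \<psi>(2)[OF that] by simp
      show "\<exists>T. open T \<and> q \<in> T \<and> smooth_on (\<lambda>q. ?k q * \<psi> q) T"
        if sing: "q \<in> V" "lambda_tmb x \<Omega> q = 0" for q
      proof -
        obtain T where T: "open T" "q \<in> T" "T \<subseteq> V" "smooth_on ?k T"
          using near[OF sing] by blast
        then have "smooth_on (\<lambda>q. ?k q * \<psi> q) T"
          by (intro smooth_on_mult smooth_on_subset[OF \<psi>(1)])
        with T show ?thesis by blast
      qed
    qed
  qed
qed

text \<open>Substituting the factorisation of \<open>K_tmb\<close> into
  \<open>second_form_identity\<close> makes \<lambda> a common factor of the right side; near
  singular points one may divide by \<open>2 * ?H\<close>.\<close>

lemma K_tmb_ideal_imp_second_fundamental_form:
  assumes V: "open V" "V \<subseteq> U"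
    and ki: "\<forall>q\<in>V. relative_principal_curvature i x \<Omega> q \<noteq> 0"
    and K: "K_tmb \<Omega> \<in> smooth_principal_ideal V (lambda_tmb x \<Omega>)"
  shows "(\<lambda>q. second_fundamental_form x \<Omega> q $ a $ b) \<in> smooth_principal_ideal V (lambda_tmb x \<Omega>)"
proof -
  let ?l = "lambda_tmb x \<Omega>" and ?H = "H_tmb x \<Omega>"
  let ?M = "\<lambda>q. second_fundamental_form x \<Omega> q $ a $ b"
  from K obtain \<phi> where \<phi>: "smooth_on \<phi> V" "\<And>q. q \<in> V \<Longrightarrow> K_tmb \<Omega> q = \<phi> q * ?l q"
    by (auto simp: smooth_principal_ideal_def)
  define N where "N q = (mu_tmb \<Omega> q ** I_tmb \<Omega> q ** transpose (mu_tmb \<Omega> q)) $ a $ b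
      + \<phi> q * first_fundamental_form x q $ a $ b" for q
  have N: "smooth_on N V"
    unfolding N_def using V smooth_on_third_form smooth_on_first_fundamental_form \<phi>(1)
    by (intro smooth_on_add smooth_on_mult) (blast intro: smooth_on_subset)+
  have id: "2 * ?H q * ?M q = ?l q * N q" if "q \<in> V" for q
  proof -
    have q: "q \<in> U" using that V(2) by blast
    show ?thesis
      using second_form_identity[OF I_tmb_sym tmb_pointwise(2)[OF q] tmb_pointwise(3)[OF q]
          tmb_pointwise(1)[OF q] H_tmb_def, of a b] \<phi>(2)[OF that]
      by (simp add: N_def lambda_tmb_def K_tmb_def algebra_simps)
  qed
  \<comment> \<open>\<open>?H\<close> can vanish only at points of \<open>V\<close> where \<lambda>
    is nonzero; there the plain quotient is used.\<close>
  define \<psi> where "\<psi> q = (if ?H q = 0 then ?M q / ?l q else N q / (2 * ?H q))" for q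
  have H: "smooth_on ?H V" using smooth_on_H_tmb V(2) by (rule smooth_on_subset)
  show ?thesis
  proof (rule smooth_principal_idealI[OF V(1), of _ _ \<psi>])
    show "smooth_on ?l V" using smooth_on_lambda_tmb V(2) by (rule smooth_on_subset)
    show "smooth_on ?M V" using smooth_on_second_fundamental_form V(2) by (rule smooth_on_subset)
    show "?M q = \<psi> q * ?l q" if "q \<in> V" for q
      using id[OF that] H_tmb_nonzero ki that by (auto simp: \<psi>_def field_simps)
    show "\<exists>T. open T \<and> q \<in> T \<and> smooth_on \<psi> T" if q: "q \<in> V" and "?l q = 0" for q
    proof -
      let ?T = "{r\<in>V. ?H r \<noteq> 0}"
      have T: "open ?T"
        by (intro open_Collect_nonzero V smooth_on_imp_continuous_on H)
      have "smooth_on (\<lambda>q. N q / (2 * ?H q)) ?T"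
        by (intro smooth_on_divide smooth_on_mult smooth_on_const T smooth_on_subset[OF N]
            smooth_on_subset[OF H]) auto
      then have "smooth_on \<psi> ?T"
        by (subst smooth_on_cong[OF T, of _ "\<lambda>q. N q / (2 * ?H q)"]) (auto simp: \<psi>_def)
      moreover have "?H q \<noteq> 0" using H_tmb_nonzero ki that by blast
      ultimately show ?thesis using T q by blast
    qed
  qed
qed

text \<open>The determinant of the second form carries \<lambda> squared by hypothesis and \<lambda>
  once by \<open>det_fundamental_forms\<close>. One factor cancels at regular points, and density
  does the rest.\<close>

lemma second_fundamental_form_ideal_imp_K_tmb:
  assumes proper: "proper_on x U" and V: "open V" "V \<subseteq> U"
    and e: "coeff_e x \<Omega> \<in> smooth_principal_ideal V (lambda_tmb x \<Omega>)"
    and f: "coeff_f x \<Omega> \<in> smooth_principal_ideal V (lambda_tmb x \<Omega>)"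
    and g: "coeff_g x \<Omega> \<in> smooth_principal_ideal V (lambda_tmb x \<Omega>)"
  shows "K_tmb \<Omega> \<in> smooth_principal_ideal V (lambda_tmb x \<Omega>)"
proof -
  let ?l = "lambda_tmb x \<Omega>" and ?D = "\<lambda>q. det (I_tmb \<Omega> q)"
  from e f g obtain e' f' g' where smooth: "smooth_on e' V" "smooth_on f' V" "smooth_on g' V"
    and coeffs: "\<And>q. q \<in> V \<Longrightarrow> coeff_e x \<Omega> q = e' q * ?l q"
      "\<And>q. q \<in> V \<Longrightarrow> coeff_f x \<Omega> q = f' q * ?l q"
      "\<And>q. q \<in> V \<Longrightarrow> coeff_g x \<Omega> q = g' q * ?l q"
    unfolding smooth_principal_ideal_def by blast
  \<comment> \<open>The determinant of the second form divided by \<lambda>, over the Gram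
    determinant.\<close>
  let ?B = "\<lambda>q. (e' q * g' q - (f' q)\<^sup>2) / ?D q"
  have D: "?D q > 0" if "q \<in> V" for q using I_tmb_pos(1)[OF \<Omega>] that V(2) by blast
  have B: "smooth_on ?B V"
    using smooth_on_det_I_tmb smooth V(2) D
    by (intro smooth_on_divide smooth_on_diff smooth_on_mult smooth_on_power V(1))
      (auto intro: smooth_on_subset dest: less_imp_neq[symmetric])
  have "K_tmb \<Omega> q = ?B q * ?l q" if q: "q \<in> V" for q
  proof (rule proper_on_eq_on[OF proper V(1) _ _ _ q])
    show "continuous_on V (K_tmb \<Omega>)"
      using smooth_on_K_tmb V(2) by (blast intro: smooth_on_imp_continuous_on smooth_on_subset)
    show "continuous_on V (\<lambda>q. ?B q * ?l q)"
      using smooth_on_lambda_tmb V(2) B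
      by (intro continuous_on_mult) (blast intro: smooth_on_imp_continuous_on smooth_on_subset)+
  next
    fix r assume r: "r \<in> V" "r \<notin> singular_set x U"
    then have rU: "r \<in> U" and l: "?l r \<noteq> 0"
      using V(2) singular_set_iff_lambda_tmb[OF x \<Omega>, of r] by auto
    have "?l r * (K_tmb \<Omega> r * ?D r) = ?l r * (?l r * (e' r * g' r - (f' r)\<^sup>2))"
      using det_fundamental_forms(1)[OF rU] coeffs[OF r(1)]
      by (simp add: algebra_simps power2_eq_square)
    then have "K_tmb \<Omega> r * ?D r = ?l r * (e' r * g' r - (f' r)\<^sup>2)"
      using l unfolding mult_cancel_left by blast
    then show "K_tmb \<Omega> r = ?B r * ?l r"
      using D[OF r(1)] by (simp add: field_simps)
  qed
  with B show ?thesis by (auto simp: smooth_principal_ideal_def)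
qed

end

theorem theorem4p2:
  fixes x :: "real^2 \<Rightarrow> real^3" and \<Omega> :: "real^2 \<Rightarrow> real^2^3"
    and U V :: "(real^2) set" and p :: "real^2"
    and i j :: nat and kj :: "real^2 \<Rightarrow> real"
  assumes "open U"
    and "wavefront x U"
    and "proper_on x U"
    and "\<forall>q\<in>singular_set x U. rank (jacobian x (at q)) = 1"
    and "tangent_moving_basis x U \<Omega>"
    and "p \<in> singular_set x U"
    and "open V" and "p \<in> V" and "V \<subseteq> U"
    and "{i, j} = {1, 2}"
    and "\<forall>q\<in>V. relative_principal_curvature i x \<Omega> q \<noteq> 0"
    and "smooth_on kj V"
    and "\<forall>q\<in>V - singular_set x U. kj q = principal_curvature j x \<Omega> q"
  shows "((\<exists>K. smooth_on K V \<and> (\<forall>q\<in>V - singular_set x U. K q = gauss_curvature x \<Omega> q))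
            \<longleftrightarrow> K_tmb \<Omega> \<in> smooth_principal_ideal V (lambda_tmb x \<Omega>))
       \<and> (K_tmb \<Omega> \<in> smooth_principal_ideal V (lambda_tmb x \<Omega>)
            \<longleftrightarrow> kj \<in> smooth_principal_ideal V (lambda_tmb x \<Omega>))
       \<and> (kj \<in> smooth_principal_ideal V (lambda_tmb x \<Omega>)
            \<longleftrightarrow> coeff_e x \<Omega> \<in> smooth_principal_ideal V (lambda_tmb x \<Omega>)
              \<and> coeff_f x \<Omega> \<in> smooth_principal_ideal V (lambda_tmb x \<Omega>)
              \<and> coeff_g x \<Omega> \<in> smooth_principal_ideal V (lambda_tmb x \<Omega>))"
proof -
  have x: "smooth_on x U" using assms(2) by (simp add: wavefront_def)
  \<comment> \<open>Statement (2) serves as the hub: each other statement is linked to it.\<close>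
  have "coeff_e x \<Omega> \<in> smooth_principal_ideal V (lambda_tmb x \<Omega>)
      \<and> coeff_f x \<Omega> \<in> smooth_principal_ideal V (lambda_tmb x \<Omega>)
      \<and> coeff_g x \<Omega> \<in> smooth_principal_ideal V (lambda_tmb x \<Omega>)"
    if "K_tmb \<Omega> \<in> smooth_principal_ideal V (lambda_tmb x \<Omega>)"
    unfolding coeff_e_def[abs_def] coeff_f_def[abs_def] coeff_g_def[abs_def]
    by (intro conjI K_tmb_ideal_imp_second_fundamental_form[OF assms(1) x assms(5,7,9,11) that])
  then show ?thesis
    using K_tmb_ideal_iff_gauss_curvature_extends[OF assms(1) x assms(5,3,7,9)]
      K_tmb_ideal_iff_principal_curvature[OF assms(1) x assms(5,3,7,9-13)]
      second_fundamental_form_ideal_imp_K_tmb[OF assms(1) x assms(5,3,7,9)]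
    by blast
qed

end
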